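(* Let $c(x,y)=|x-y|$ or $c(x,y)=-|x-y|$ on $\mathbb{R}^d\times\mathbb{R}^d$, and let $\Gamma\in\mathcal{S}_{MT}$ be a $c$-contact layer; in the minimization case, assume that $x\notin\Gamma_x$ for every $x\in X_\Gamma$. Then for $\mathcal{L}^d$-a.e. $x$ in $X_\Gamma$, the closure $\overline{\Gamma_x}$ coincides with the set of extreme points of the convex hull of $\overline{\Gamma_x}$, i.e. $\overline{\Gamma_x}=\mathrm{Ext}\big(\mathrm{conv}(\overline{\Gamma_x})\big)$. In particular, let $\mu\le_C\nu$ be probability measures on $\mathbb{R}^d$ with $\mu$ absolutely continuous with respect to the Lebesgue measure, and let $\pi\in MT(\mu,\nu)$ be a solution of either the minimization or the maximization problem for the cost $|x-y|$ (in the case of minimization assume $\mu\wedge\nu=0$). If the corresponding dual problem is attained, then for $\mu$-a.e. $x$, $\mathrm{supp}\,\pi_x=\mathrm{Ext}\big(\mathrm{conv}(\mathrm{supp}\,\pi_x)\big)$.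
   Context: For $A\subset\mathbb{R}^d$, $IC(A)$ is the interior of $\mathrm{conv}(A)$ relative to the affine hull of $A$ (so $IC(\{x\})=\{x\}$). For $\Gamma\subset\mathbb{R}^d\times\mathbb{R}^d$: $\Gamma_x:=\{y:(x,y)\in\Gamma\}$, and $X_\Gamma$, $Y_\Gamma$ are the projections of $\Gamma$ on the first and second coordinates. $\mathcal{S}_{MT}$ is the class of Borel sets $\Gamma\subset\mathbb{R}^d\times\mathbb{R}^d$ with $x\in IC(\Gamma_x)$ for every $x\in X_\Gamma$. $\mathcal{L}^d$ is Lebesgue measure. For $X,Y\subset\mathbb{R}^d$, a triplet of measurable functions $\alpha:X\to\mathbb{R}$, $\gamma:X\to\mathbb{R}^d$, $\beta:Y\to\mathbb{R}$ is an admissible triple in $E_m(c,X,Y)$ if $\beta(y)-\alpha(x)-\gamma(x)\cdot(y-x)\le c(x,y)$ on $X\times Y$, and in $E_M(c,X,Y)$ if the reverse inequality holds. $\Gamma$ is a $c$-contact layer if it is nonempty and there is a triple in $E_m(c,X_\Gamma,Y_\Gamma)$ or $E_M(c,X_\Gamma,Y_\Gamma)$ with $\beta(y)-\alpha(x)-\gamma(x)\cdot(y-x)=c(x,y)$ on $\Gamma$. The "minimization case" is $c=|x-y|$ with a triple in $E_m$, or equivalently $c=-|x-y|$ with a triple in $E_M$; the other two combinations are the maximization case. $\mu\le_C\nu$ (convex order): $\mu,\nu$ have finite first moments and $\int\varphi\,d\mu\le\int\varphi\,d\nu$ for all convex $\varphi$ on $\mathbb{R}^d$. $MT(\mu,\nu)$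 is the set of probability measures $\pi$ on $\mathbb{R}^d\times\mathbb{R}^d$ with marginals $\mu,\nu$ whose disintegration $d\pi(x,y)=d\pi_x(y)d\mu(x)$ has $\pi_x$ with barycenter $x$ for $\mu$-a.e. $x$. The optimization problem is to minimize (or maximize) $\int c\,d\pi$ over $\pi\in MT(\mu,\nu)$. The dual problem for minimization (resp. maximization) is to maximize (resp. minimize) $\int\beta\,d\nu-\int\alpha\,d\mu$ over triples $(\alpha,\gamma,\beta)$ in $E_m(c,\mathbb{R}^d,\mathbb{R}^d)$ (resp. $E_M(c,\mathbb{R}^d,\mathbb{R}^d)$); it is attained if for some such triple $\int\beta\,d\nu-\int\alpha\,d\mu$ equals the optimal value of $\int c\,d\pi$. $\mu\wedge\nu$ is the largest measure dominated by both $\mu$ and $\nu$. *)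

theory Defs
  imports "HOL-Probability.Probability"
begin

text \<open>
  A set \<open>\<Gamma>\<close> of pairs is treated as a relation: \<open>\<Gamma> `` {x}\<close> is the section over \<open>x\<close>, and
  \<open>Domain \<Gamma>\<close>, \<open>Range \<Gamma>\<close> are its projections on the first and second coordinates.
\<close>

definition IC :: "'a::euclidean_space set \<Rightarrow> 'a set" where
  "IC A = rel_interior (convex hull A)"

definition Ext :: "'a::euclidean_space set \<Rightarrow> 'a set" where
  "Ext S = {e. e extreme_point_of S}"

definition S_MT :: "('a::euclidean_space \<times> 'a) set set" where
  "S_MT = {\<Gamma> \<in> sets borel. \<forall>x\<in>Domain \<Gamma>. x \<in> IC (\<Gamma> `` {x})}"

text \<open>
  Functions on subsets of the space are represented by total functions of which only the
  restriction matters; measurability on \<open>X\<close> refers to the trace of the Borel sigma-algebra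
  (\<open>X\<close> itself need not be a Borel set, e.g. when it is a projection of one).
\<close>

type_synonym 'a triple = "('a \<Rightarrow> real) \<times> ('a \<Rightarrow> 'a) \<times> ('a \<Rightarrow> real)"

definition measurable_triples ::
    "'a::euclidean_space set \<Rightarrow> 'a set \<Rightarrow> 'a triple set" where
  "measurable_triples X Y = {(\<alpha>, \<gamma>, \<beta>).
     \<alpha> \<in> borel_measurable (restrict_space borel X) \<and>
     \<gamma> \<in> borel_measurable (restrict_space borel X) \<and>
     \<beta> \<in> borel_measurable (restrict_space borel Y)}"

definition E_m :: "('a::euclidean_space \<Rightarrow> 'a \<Rightarrow> real) \<Rightarrow> 'a set \<Rightarrow> 'a set \<Rightarrow> 'a triple set" where
  "E_m c X Y = {(\<alpha>, \<gamma>, \<beta>) \<in> measurable_triples X Y.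
     \<forall>x\<in>X. \<forall>y\<in>Y. \<beta> y - \<alpha> x - \<gamma> x \<bullet> (y - x) \<le> c x y}"

definition E_M :: "('a::euclidean_space \<Rightarrow> 'a \<Rightarrow> real) \<Rightarrow> 'a set \<Rightarrow> 'a set \<Rightarrow> 'a triple set" where
  "E_M c X Y = {(\<alpha>, \<gamma>, \<beta>) \<in> measurable_triples X Y.
     \<forall>x\<in>X. \<forall>y\<in>Y. \<beta> y - \<alpha> x - \<gamma> x \<bullet> (y - x) \<ge> c x y}"

definition contact_on ::
    "('a::euclidean_space \<Rightarrow> 'a \<Rightarrow> real) \<Rightarrow> ('a \<times> 'a) set \<Rightarrow> 'a triple \<Rightarrow> bool" where
  "contact_on c \<Gamma> = (\<lambda>(\<alpha>, \<gamma>, \<beta>). \<forall>(x, y)\<in>\<Gamma>. \<beta> y - \<alpha> x - \<gamma> x \<bullet> (y - x) = c x y)"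

definition contact_layer_m ::
    "('a::euclidean_space \<Rightarrow> 'a \<Rightarrow> real) \<Rightarrow> ('a \<times> 'a) set \<Rightarrow> bool" where
  "contact_layer_m c \<Gamma> \<longleftrightarrow> \<Gamma> \<noteq> {} \<and> (\<exists>t \<in> E_m c (Domain \<Gamma>) (Range \<Gamma>). contact_on c \<Gamma> t)"

definition contact_layer_M ::
    "('a::euclidean_space \<Rightarrow> 'a \<Rightarrow> real) \<Rightarrow> ('a \<times> 'a) set \<Rightarrow> bool" where
  "contact_layer_M c \<Gamma> \<longleftrightarrow> \<Gamma> \<noteq> {} \<and> (\<exists>t \<in> E_M c (Domain \<Gamma>) (Range \<Gamma>). contact_on c \<Gamma> t)"

definition contact_layer ::
    "('a::euclidean_space \<Rightarrow> 'a \<Rightarrow> real) \<Rightarrow> ('a \<times> 'a) set \<Rightarrow> bool" where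
  "contact_layer c \<Gamma> \<longleftrightarrow> contact_layer_m c \<Gamma> \<or> contact_layer_M c \<Gamma>"

definition dist_cost :: "'a::euclidean_space \<Rightarrow> 'a \<Rightarrow> real" where
  "dist_cost x y = norm (x - y)"

definition neg_dist_cost :: "'a::euclidean_space \<Rightarrow> 'a \<Rightarrow> real" where
  "neg_dist_cost x y = - norm (x - y)"

text \<open>
  The two cases are properties of the cost together with a triple, so in degenerate situations
  one and the same layer can fall under both of them, by way of different triples.
\<close>

definition minimization_case ::
    "('a::euclidean_space \<Rightarrow> 'a \<Rightarrow> real) \<Rightarrow> ('a \<times> 'a) set \<Rightarrow> bool" where
  "minimization_case c \<Gamma> \<longleftrightarrow>
     c = dist_cost \<and> contact_layer_m c \<Gamma> \<or> c = neg_dist_cost \<and> contact_layer_M c \<Gamma>"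

definition maximization_case ::
    "('a::euclidean_space \<Rightarrow> 'a \<Rightarrow> real) \<Rightarrow> ('a \<times> 'a) set \<Rightarrow> bool" where
  "maximization_case c \<Gamma> \<longleftrightarrow>
     c = dist_cost \<and> contact_layer_M c \<Gamma> \<or> c = neg_dist_cost \<and> contact_layer_m c \<Gamma>"

text \<open>
  A convex \<open>\<phi>\<close> has an affine minorant, so under finite first moments its integrals are well
  defined in \<open>(-\<infinity>, \<infinity>]\<close>. The comparison of the integrals is void if the one with respect to
  \<open>\<nu>\<close> is infinite, and otherwise asserts in particular that the one with respect to \<open>\<mu>\<close> is finite.
\<close>

definition convex_order :: "'a::euclidean_space measure \<Rightarrow> 'a measure \<Rightarrow> bool" where
  "convex_order \<mu> \<nu> \<longleftrightarrow>
     integrable \<mu> norm \<and> integrable \<nu> norm \<and>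
     (\<forall>\<phi>. convex_on UNIV \<phi> \<and> integrable \<nu> \<phi> \<longrightarrow>
        integrable \<mu> \<phi> \<and> (\<integral>x. \<phi> x \<partial>\<mu>) \<le> (\<integral>y. \<phi> y \<partial>\<nu>))"

definition disintegration ::
    "'a::euclidean_space measure \<Rightarrow> ('a \<times> 'a) measure \<Rightarrow> ('a \<Rightarrow> 'a measure) \<Rightarrow> bool" where
  "disintegration \<mu> \<pi> \<kappa> \<longleftrightarrow>
     \<kappa> \<in> measurable \<mu> (prob_algebra borel) \<and>
     (\<forall>A\<in>sets borel. emeasure \<pi> A = (\<integral>\<^sup>+x. emeasure (\<kappa> x) {y. (x, y) \<in> A} \<partial>\<mu>))"

definition has_barycenter :: "'a::euclidean_space measure \<Rightarrow> 'a \<Rightarrow> bool" where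
  "has_barycenter M b \<longleftrightarrow> integrable M (\<lambda>y. y) \<and> (\<integral>y. y \<partial>M) = b"

definition MT ::
    "'a::euclidean_space measure \<Rightarrow> 'a measure \<Rightarrow> ('a \<times> 'a) measure set" where
  "MT \<mu> \<nu> = {\<pi>. prob_space \<pi> \<and> sets \<pi> = sets borel \<and>
     distr \<pi> borel fst = \<mu> \<and> distr \<pi> borel snd = \<nu> \<and>
     (\<exists>\<kappa>. disintegration \<mu> \<pi> \<kappa> \<and> (AE x in \<mu>. has_barycenter (\<kappa> x) x))}"

definition total_cost ::
    "('a::euclidean_space \<Rightarrow> 'a \<Rightarrow> real) \<Rightarrow> ('a \<times> 'a) measure \<Rightarrow> real" where
  "total_cost c \<pi> = (\<integral>p. c (fst p) (snd p) \<partial>\<pi>)"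

definition solves_min ::
    "('a::euclidean_space \<Rightarrow> 'a \<Rightarrow> real) \<Rightarrow> 'a measure \<Rightarrow> 'a measure \<Rightarrow> ('a \<times> 'a) measure \<Rightarrow> bool" where
  "solves_min c \<mu> \<nu> \<pi> \<longleftrightarrow> \<pi> \<in> MT \<mu> \<nu> \<and> (\<forall>\<pi>'\<in>MT \<mu> \<nu>. total_cost c \<pi> \<le> total_cost c \<pi>')"

definition solves_max ::
    "('a::euclidean_space \<Rightarrow> 'a \<Rightarrow> real) \<Rightarrow> 'a measure \<Rightarrow> 'a measure \<Rightarrow> ('a \<times> 'a) measure \<Rightarrow> bool" where
  "solves_max c \<mu> \<nu> \<pi> \<longleftrightarrow> \<pi> \<in> MT \<mu> \<nu> \<and> (\<forall>\<pi>'\<in>MT \<mu> \<nu>. total_cost c \<pi>' \<le> total_cost c \<pi>)"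

text \<open>
  Since the optimal value is a real number, the dual value of an optimal triple can only make
  sense if \<open>\<alpha>\<close> and \<open>\<beta>\<close> are integrable. No integrability is imposed on \<open>\<gamma>\<close>.
  The real infimum and supremum are the genuine ones if the cost is \<open>dist_cost\<close> or
  \<open>neg_dist_cost\<close>, \<open>\<mu>\<close> and \<open>\<nu>\<close> have finite first moments and \<open>MT \<mu> \<nu>\<close> is nonempty.
\<close>

definition dual_min_attained ::
    "('a::euclidean_space \<Rightarrow> 'a \<Rightarrow> real) \<Rightarrow> 'a measure \<Rightarrow> 'a measure \<Rightarrow> bool" where
  "dual_min_attained c \<mu> \<nu> \<longleftrightarrow> (\<exists>(\<alpha>, \<gamma>, \<beta>) \<in> E_m c UNIV UNIV.
     integrable \<mu> \<alpha> \<and> integrable \<nu> \<beta> \<and>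
     (\<integral>y. \<beta> y \<partial>\<nu>) - (\<integral>x. \<alpha> x \<partial>\<mu>) = (INF \<pi>\<in>MT \<mu> \<nu>. total_cost c \<pi>))"

definition dual_max_attained ::
    "('a::euclidean_space \<Rightarrow> 'a \<Rightarrow> real) \<Rightarrow> 'a measure \<Rightarrow> 'a measure \<Rightarrow> bool" where
  "dual_max_attained c \<mu> \<nu> \<longleftrightarrow> (\<exists>(\<alpha>, \<gamma>, \<beta>) \<in> E_M c UNIV UNIV.
     integrable \<mu> \<alpha> \<and> integrable \<nu> \<beta> \<and>
     (\<integral>y. \<beta> y \<partial>\<nu>) - (\<integral>x. \<alpha> x \<partial>\<mu>) = (SUP \<pi>\<in>MT \<mu> \<nu>. total_cost c \<pi>))"

definition supp :: "'a::topological_space measure \<Rightarrow> 'a set" where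
  "supp M = {y. \<forall>U. open U \<and> y \<in> U \<longrightarrow> emeasure M U > 0}"

text \<open>
  For measures on the same sigma-algebra the lattice order is setwise comparison, so that
  \<open>inf \<mu> \<nu>\<close> is the largest measure dominated by both \<open>\<mu>\<close> and \<open>\<nu>\<close>.
\<close>

lemma inf_measure_greatest:
  fixes \<mu> \<nu> :: "'a::topological_space measure"
  assumes "sets \<mu> = sets borel" "sets \<nu> = sets borel"
  shows "sets (inf \<mu> \<nu>) = sets borel"
    and "emeasure (inf \<mu> \<nu>) A \<le> emeasure \<mu> A" "emeasure (inf \<mu> \<nu>) A \<le> emeasure \<nu> A"
    and "\<lbrakk>sets M = sets borel; \<And>A. emeasure M A \<le> emeasure \<mu> A; \<And>A. emeasure M A \<le> emeasure \<nu> A\<rbrakk>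
      \<Longrightarrow> emeasure M A \<le> emeasure (inf \<mu> \<nu>) A"
proof -
  have sp: "space \<mu> = UNIV" "space \<nu> = UNIV"
    using assms[THEN sets_eq_imp_space_eq] by simp_all
  have "null_measure borel \<le> \<mu>" "null_measure borel \<le> \<nu>"
    using assms sp by (auto simp: le_measure_iff le_fun_def)
  then have lo: "null_measure borel \<le> inf \<mu> \<nu>"
    by simp
  have up: "inf \<mu> \<nu> \<le> \<mu>" "inf \<mu> \<nu> \<le> \<nu>"
    by simp_all
  have sp_inf: "space (inf \<mu> \<nu>) = UNIV"
    using lo sp by (auto simp: le_measure_iff split: if_splits)
  show s: "sets (inf \<mu> \<nu>) = sets borel"
    using lo up(1) sp sp_inf assms by (auto simp: le_measure_iff split: if_splits)
  show "emeasure (inf \<mu> \<nu>) A \<le> emeasure \<mu> A" "emeasure (inf \<mu> \<nu>) A \<le> emeasure \<nu> A"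
    using up sp sp_inf s assms by (simp_all add: le_measure_iff le_fun_def)
  show "emeasure M A \<le> emeasure (inf \<mu> \<nu>) A"
    if M: "sets M = sets borel" "\<And>A. emeasure M A \<le> emeasure \<mu> A"
      "\<And>A. emeasure M A \<le> emeasure \<nu> A"
  proof -
    have spM: "space M = UNIV"
      using M(1)[THEN sets_eq_imp_space_eq] by simp
    have "M \<le> \<mu>" "M \<le> \<nu>"
      using M spM sp assms by (simp_all add: le_measure_iff le_fun_def)
    then have "M \<le> inf \<mu> \<nu>"
      by simp
    then show ?thesis
      using spM sp_inf M(1) s by (simp add: le_measure_iff le_fun_def)
  qed
qed

end

theory Submission
  imports Defs
begin

text \<open>
  The two cost cases differ only by a sign \<open>s\<close>: a contact layer is given by \<open>\<alpha>\<close>, \<open>\<gamma>\<close>, \<open>\<beta>\<close> for which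
  \<open>s * (\<beta> y - \<alpha> x - \<gamma> x \<bullet> (y - x) - norm (x - y))\<close> is nonnegative, and zero on \<open>\<Gamma>\<close>, with \<open>s = 1\<close>
  for maximization and \<open>s = - 1\<close> for minimization. If \<open>\<alpha>\<close> and \<open>\<gamma>\<close> were differentiable at \<open>x\<close>, then
  differentiating in \<open>x\<close> at a contact point \<open>(x, y)\<close> would show that the unit vector
  \<open>sgn (x - y)\<close> is an affine function of \<open>y \<in> \<Gamma> `` {x}\<close>. This affine dependence is what the theorem rests on,
  but \<open>\<gamma> x\<close> is not even determined in directions transversal to \<open>\<Gamma> `` {x}\<close>, so it is obtained
  without any differentiability, as follows.

  Let \<open>Z\<close> be the convex hull of the points \<open>(y, sgn (x - y))\<close> with \<open>y \<in> \<Gamma> `` {x}\<close>. Comparing the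
  contact equality over \<open>x\<close> with the inequality over another base point \<open>x'\<close>, and averaging over a
  convex combination of the \<open>y\<close> that equals \<open>x\<close>, shows that \<open>x \<mapsto> s *\<^sub>R (\<gamma> x + w)\<close>, for \<open>w\<close> with
  \<open>(x, w) \<in> Z\<close>, becomes a monotone multivalued map after adding a multiple of the identity; the
  multiple bounds the curvature of the distance functions involved, and it is uniform once the
  \<open>y\<close> are kept at a fixed distance from \<open>x\<close> (\<open>monotone_relation_centre\<close>). A monotone
  relation is multivalued only on a null set, because the places where two values are separated in
  a coordinate direction satisfy a cone condition and so lie on countably many Lipschitz graphs
  (\<open>negligible_multivalued_of_monotone_relation\<close>). Hence for almost every \<open>x\<close> there is at
  most one \<open>w\<close> with \<open>(x, w) \<in> Z\<close>. As \<open>x\<close> lies in the relative interior of the convex hull of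
  \<open>\<Gamma> `` {x}\<close>, uniqueness over the single point \<open>x\<close> spreads to every point of that hull, and a
  convex set that is a graph is the graph of an affine map (\<open>affine_extension_of_graph\<close>). The
  diagonal has to be avoided: in the maximization case the points \<open>x \<in> \<Gamma> `` {x}\<close> form a null set
  because there every vector of the unit ball serves as a direction, so a monotone relation is
  multivalued at all of them (\<open>negligible_diagonal\<close>).

  The rest is strict convexity of the Euclidean ball. If the affine map \<open>L\<close> takes the unit
  value \<open>sgn (x - y)\<close> at each \<open>y \<in> \<Gamma> `` {x}\<close> and \<open>y\<close> lies strictly between points \<open>a\<close>, \<open>b\<close> of the hull, then
  \<open>L a = L b = L y\<close>, which puts \<open>a\<close> and \<open>b\<close> on one ray from \<open>x\<close>; then \<open>L\<close> is constant on the line of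
  that ray and so of norm one at \<open>x\<close>, which is impossible for an \<open>x\<close> in the hull
  (\<open>extreme_points_of_affine_directions\<close>).

  For an optimal plan with an optimal dual triple, the difference between cost and dual
  functional integrates to zero and has a sign, so almost every section measure \<open>\<kappa> x\<close> is carried by
  contact points (\<open>AE_contact_of_dual_optimal\<close>). Intersecting the contact set with the supports gives
  a layer whose sections are dense in the supports, and \<open>x\<close> lies in the relative interior of
  their hull because it is the barycentre of \<open>\<kappa> x\<close> (\<open>barycenter_in_IC\<close>).
\<close>

section \<open>Null sets: cones and monotone relations\<close>

text \<open>
  The orthogonal projection along \<open>e\<close> is injective on such a set with a Lipschitz inverse, so the
  set is a Lipschitz image of a subset of a hyperplane.
\<close>

lemma negligible_of_cone_condition:
  fixes S :: "'a::euclidean_space set"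
  assumes e: "norm e = 1"
    and cone: "\<And>x y. x \<in> S \<Longrightarrow> y \<in> S \<Longrightarrow>
      \<bar>e \<bullet> (x - y)\<bar> \<le> C * norm ((x - y) - (e \<bullet> (x - y)) *\<^sub>R e)"
  shows "negligible S"
proof -
  define P where "P z = z - (e \<bullet> z) *\<^sub>R e" for z :: 'a
  have diff: "P x - P y = (x - y) - (e \<bullet> (x - y)) *\<^sub>R e" for x y
    by (simp add: P_def inner_diff_right algebra_simps)
  have lip: "norm (x - y) \<le> (1 + C) * norm (P x - P y)" if "x \<in> S" "y \<in> S" for x y
  proof -
    have "norm (x - y) = norm ((P x - P y) + (e \<bullet> (x - y)) *\<^sub>R e)"
      by (simp add: diff)
    also have "\<dots> \<le> norm (P x - P y) + \<bar>e \<bullet> (x - y)\<bar>"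
      using norm_triangle_ineq[of "P x - P y" "(e \<bullet> (x - y)) *\<^sub>R e"] e by simp
    also have "\<dots> \<le> norm (P x - P y) + C * norm (P x - P y)"
      using cone[OF that] by (simp add: diff)
    finally show ?thesis
      by (simp add: algebra_simps)
  qed
  have inj: "inj_on P S"
    using lip by (fastforce intro: inj_onI)
  define g where "g = inv_into S P"
  have g: "g (P x) = x" if "x \<in> S" for x
    using that inj by (simp add: g_def)
  have "e \<bullet> P x = 0" for x
    using e by (simp add: P_def inner_diff_right dot_square_norm)
  then have "P ` S \<subseteq> {z. e \<bullet> z = 0}"
    by auto
  moreover have "negligible {z. e \<bullet> z = 0}"
    using e by (intro negligible_hyperplane) auto
  ultimately have "negligible (P ` S)"
    using negligible_subset by blast
  then have "negligible (g ` (P ` S))"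
  proof (rule negligible_locally_Lipschitz_image[OF order_refl])
    fix z assume "z \<in> P ` S"
    then have "\<forall>y\<in>P ` S \<inter> UNIV. norm (g y - g z) \<le> (1 + C) * norm (y - z)"
      using lip g by auto
    then show "\<exists>T B. open T \<and> z \<in> T \<and> (\<forall>y\<in>P ` S \<inter> T. norm (g y - g z) \<le> B * norm (y - z))"
      by blast
  qed
  moreover have "g ` (P ` S) = S"
    using g by force
  ultimately show ?thesis
    by simp
qed

definition monotone_relation :: "('a::euclidean_space \<times> 'a) set \<Rightarrow> bool" where
  "monotone_relation M \<longleftrightarrow> (\<forall>(x, t)\<in>M. \<forall>(x', t')\<in>M. 0 \<le> (t - t') \<bullet> (x - x'))"

lemma monotone_relationI:
  assumes "\<And>x t x' t'. (x, t) \<in> M \<Longrightarrow> (x', t') \<in> M \<Longrightarrow> 0 \<le> (t - t') \<bullet> (x - x')"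
  shows "monotone_relation M"
  using assms by (auto simp: monotone_relation_def)

text \<open>
  If values of norm at most \<open>k\<close> below \<open>p\<close> and above \<open>q\<close> in direction \<open>e\<close> are attained at both
  \<open>x\<close> and \<open>y\<close>, then monotonicity applied to a low value at one point and a high value at the other
  prevents \<open>x - y\<close> from being nearly parallel to \<open>e\<close>. Two distinct values at a point differ in some
  coordinate, so countably many choices of \<open>e\<close>, \<open>p\<close>, \<open>q\<close>, \<open>k\<close> cover all points in question.
\<close>

lemma negligible_multivalued_of_monotone_relation:
  fixes M :: "('a::euclidean_space \<times> 'a) set"
  assumes mono: "monotone_relation M"
  shows "negligible {x. \<exists>t t'. (x, t) \<in> M \<and> (x, t') \<in> M \<and> t \<noteq> t'}"
proof -
  define S where "S e p q k = {x. \<exists>t t'. (x, t) \<in> M \<and> (x, t') \<in> M \<and>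
      e \<bullet> t \<le> of_rat p \<and> of_rat q \<le> e \<bullet> t' \<and> norm t \<le> real k \<and> norm t' \<le> real k}"
    for e :: 'a and p q :: rat and k :: nat
  have null: "negligible (S e p q k)" if e: "e \<in> Basis" and pq: "p < q" for e p q k
  proof (rule negligible_of_cone_condition)
    define h where "h = (of_rat q - of_rat p :: real)"
    have h: "h > 0"
      using pq by (simp add: h_def of_rat_less)
    show "norm e = 1"
      using e by simp
    have one_sided: "e \<bullet> (x - y) \<le> 2 * real k / h * norm ((x - y) - (e \<bullet> (x - y)) *\<^sub>R e)"
      if x: "x \<in> S e p q k" and y: "y \<in> S e p q k" for x y
    proof (cases "e \<bullet> (x - y) \<le> 0")
      case True
      have "0 \<le> 2 * real k / h * norm ((x - y) - (e \<bullet> (x - y)) *\<^sub>R e)"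
        using h by simp
      with True show ?thesis
        by linarith
    next
      case False
      obtain t where t: "(x, t) \<in> M" "e \<bullet> t \<le> of_rat p" "norm t \<le> real k"
        using x by (auto simp: S_def)
      obtain t' where t': "(y, t') \<in> M" "of_rat q \<le> e \<bullet> t'" "norm t' \<le> real k"
        using y by (auto simp: S_def)
      let ?r = "(x - y) - (e \<bullet> (x - y)) *\<^sub>R e"
      have "0 \<le> (t - t') \<bullet> (x - y)"
        using mono t t' by (auto simp: monotone_relation_def)
      also have "\<dots> = (e \<bullet> (x - y)) * (e \<bullet> t - e \<bullet> t') + (t - t') \<bullet> ?r"
        by (simp add: inner_diff_left inner_diff_right inner_commute algebra_simps)
      also have "(e \<bullet> (x - y)) * (e \<bullet> t - e \<bullet> t') \<le> (e \<bullet> (x - y)) * (- h)"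
        using False t t' by (intro mult_left_mono) (auto simp: h_def)
      also have "(t - t') \<bullet> ?r \<le> 2 * real k * norm ?r"
      proof -
        have "(t - t') \<bullet> ?r \<le> norm (t - t') * norm ?r"
          by (rule norm_cauchy_schwarz)
        also have "\<dots> \<le> 2 * real k * norm ?r"
          using t(3) t'(3) norm_triangle_ineq4[of t t'] by (intro mult_right_mono) auto
        finally show ?thesis .
      qed
      finally show ?thesis
        using h by (simp add: field_simps)
    qed
    show "\<bar>e \<bullet> (x - y)\<bar> \<le> 2 * real k / h * norm ((x - y) - (e \<bullet> (x - y)) *\<^sub>R e)"
      if "x \<in> S e p q k" "y \<in> S e p q k" for x y
    proof -
      have "norm ((y - x) - (e \<bullet> (y - x)) *\<^sub>R e) = norm ((x - y) - (e \<bullet> (x - y)) *\<^sub>R e)"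
        using norm_minus_cancel[of "(x - y) - (e \<bullet> (x - y)) *\<^sub>R e"]
        by (simp add: inner_diff_right algebra_simps)
      then show ?thesis
        using one_sided[OF that] one_sided[OF that(2,1)] by (simp add: abs_le_iff inner_diff_right)
    qed
  qed
  define I where "I = {(e :: 'a, p :: rat, q :: rat, k :: nat). e \<in> Basis \<and> p < q}"
  have "I \<subseteq> Basis \<times> UNIV"
    by (auto simp: I_def)
  then have "countable I"
    by (rule countable_subset) (intro countable_SIGMA countable_finite countableI_type finite_Basis)
  then have "negligible (\<Union>(e, p, q, k)\<in>I. S e p q k)"
    using null by (intro negligible_countable_Union countable_image) (auto simp: I_def)
  moreover have "x \<in> (\<Union>(e, p, q, k)\<in>I. S e p q k)"
    if M: "(x, t) \<in> M" "(x, t') \<in> M" and "t \<noteq> t'" for x t t'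
  proof -
    have covered: "\<exists>p q k. p < q \<and> x \<in> S e p q k"
      if "(x, u) \<in> M" "(x, u') \<in> M" and less: "e \<bullet> u < e \<bullet> u'" for e u u'
    proof -
      obtain p :: rat where p: "e \<bullet> u < of_rat p" "of_rat p < e \<bullet> u'"
        using of_rat_dense[OF less] by auto
      obtain q :: rat where q: "of_rat p < (of_rat q :: real)" "of_rat q < e \<bullet> u'"
        using of_rat_dense[OF p(2)] by auto
      obtain k :: nat where k: "max (norm u) (norm u') \<le> real k"
        using real_arch_simple by blast
      have "p < q"
        using q by (simp add: of_rat_less)
      moreover have "x \<in> S e p q k"
        unfolding S_def mem_Collect_eq using that(1,2) p q k
        by (intro exI[of _ u] exI[of _ u']) simp
      ultimately show ?thesis
        by blast
    qed
    obtain e where e: "e \<in> Basis" "e \<bullet> t \<noteq> e \<bullet> t'"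
      using \<open>t \<noteq> t'\<close> euclidean_eq_iff[of t t'] by (auto simp: inner_commute)
    then consider "e \<bullet> t < e \<bullet> t'" | "e \<bullet> t' < e \<bullet> t"
      by linarith
    then have "\<exists>p q k. p < q \<and> x \<in> S e p q k"
      by cases (use covered M in blast)+
    with e(1) show ?thesis
      by (auto simp: I_def)
  qed
  ultimately show ?thesis
    by (elim negligible_subset) blast
qed

section \<open>Affine direction fields force extremality\<close>

text \<open>
  The cone \<open>Q\<close> over \<open>Z\<close> with apex at the unique point \<open>(x, w0)\<close> above \<open>x\<close> is a linear subspace: every
  point of \<open>Z\<close> can be reflected through the apex up to a factor, since its projection can be
  reflected through the relative interior point \<open>x\<close> and uniqueness above \<open>x\<close> forces the second
  components to follow. Uniqueness also says that \<open>Q\<close> meets the vertical directions only in zero, so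
  \<open>Q\<close> is the graph of a linear map.
\<close>

lemma affine_extension_of_graph:
  fixes Z :: "('a::euclidean_space \<times> 'b::euclidean_space) set"
  assumes Z: "convex Z" and x: "x \<in> rel_interior (fst ` Z)"
    and unique: "\<And>w w'. (x, w) \<in> Z \<Longrightarrow> (x, w') \<in> Z \<Longrightarrow> w = w'"
  obtains A c where "linear A" "\<And>y w. (y, w) \<in> Z \<Longrightarrow> w = A y + c"
proof -
  have conv: "convex (fst ` Z)"
    using Z by (simp add: convex_linear_image linear_fst)
  obtain w0 where w0: "(x, w0) \<in> Z"
    using x rel_interior_subset by fastforce
  define Q where "Q = {r *\<^sub>R (p - (x, w0)) |r p. 0 \<le> r \<and> p \<in> Z}"
  have QI: "r *\<^sub>R (p - (x, w0)) \<in> Q" if "0 \<le> r" "p \<in> Z" for r p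
    unfolding Q_def using that by blast
  have QE: "\<exists>r p. a = r *\<^sub>R (p - (x, w0)) \<and> 0 \<le> r \<and> p \<in> Z" if "a \<in> Q" for a
    using that unfolding Q_def by blast
  have zero: "0 \<in> Q"
    using QI[of 0 "(x, w0)"] w0 by simp
  have add: "a + b \<in> Q" if ab: "a \<in> Q" "b \<in> Q" for a b
  proof -
    obtain r p where a: "a = r *\<^sub>R (p - (x, w0))" "0 \<le> r" "p \<in> Z"
      using QE[OF ab(1)] by blast
    obtain s q where b: "b = s *\<^sub>R (q - (x, w0))" "0 \<le> s" "q \<in> Z"
      using QE[OF ab(2)] by blast
    show ?thesis
    proof (cases "r + s = 0")
      case True
      then have "r = 0" "s = 0"
        using a b by auto
      with a b zero show ?thesis
        by simp
    next
      case False
      let ?z = "(r / (r + s)) *\<^sub>R p + (s / (r + s)) *\<^sub>R q"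
      have "?z \<in> Z"
        using a b False by (intro convexD[OF Z]) (simp_all flip: add_divide_distrib)
      then have "(r + s) *\<^sub>R (?z - (x, w0)) \<in> Q"
        using a b by (intro QI) auto
      moreover have "(r + s) *\<^sub>R (?z - (x, w0)) = a + b"
        using False a b by (simp add: scaleR_right_diff_distrib scaleR_right_distrib scaleR_left_distrib)
      ultimately show ?thesis
        by simp
    qed
  qed
  have neg: "- (p - (x, w0)) \<in> Q" if p: "p \<in> Z" for p
  proof -
    obtain y w where yw: "p = (y, w)"
      by (cases p)
    have "y \<in> fst ` Z"
      using p yw by force
    then obtain e where e: "e > 1" "(1 - e) *\<^sub>R y + e *\<^sub>R x \<in> fst ` Z"
      using convex_rel_interior_iff[OF conv] x by blast
    then obtain w' where w': "((1 - e) *\<^sub>R y + e *\<^sub>R x, w') \<in> Z"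
      by force
    \<comment> \<open>the convex combination whose first component is \<open>x\<close>\<close>
    have "(1 / e) *\<^sub>R ((1 - e) *\<^sub>R y + e *\<^sub>R x, w') + (1 - 1 / e) *\<^sub>R (y, w) \<in> Z"
      using e p yw w' by (intro convexD[OF Z]) auto
    moreover have "(1 / e) *\<^sub>R ((1 - e) *\<^sub>R y + e *\<^sub>R x) + (1 - 1 / e) *\<^sub>R y = x"
    proof -
      have "(1 / e) *\<^sub>R ((1 - e) *\<^sub>R y + e *\<^sub>R x) + (1 - 1 / e) *\<^sub>R y
          = ((1 / e) * (1 - e) + (1 - 1 / e)) *\<^sub>R y + ((1 / e) * e) *\<^sub>R x"
        by (simp add: scaleR_add_right scaleR_add_left)
      then show ?thesis
        using e by (simp add: field_simps)
    qed
    ultimately have "(x, (1 / e) *\<^sub>R w' + (1 - 1 / e) *\<^sub>R w) \<in> Z"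
      by simp
    then have "w0 = (1 / e) *\<^sub>R w' + (1 - 1 / e) *\<^sub>R w"
      using unique w0 by blast
    then have "e *\<^sub>R w0 = e *\<^sub>R ((1 / e) *\<^sub>R w' + (1 - 1 / e) *\<^sub>R w)"
      by simp
    also have "\<dots> = w' + (e - 1) *\<^sub>R w"
      using e by (simp add: scaleR_add_right right_diff_distrib)
    finally have w'_eq: "w' = e *\<^sub>R w0 - (e - 1) *\<^sub>R w"
      by simp
    have "(1 / (e - 1)) *\<^sub>R (((1 - e) *\<^sub>R y + e *\<^sub>R x, w') - (x, w0)) \<in> Q"
      using e w' by (intro QI) auto
    moreover have "(1 / (e - 1)) *\<^sub>R (((1 - e) *\<^sub>R y + e *\<^sub>R x, w') - (x, w0)) = - (p - (x, w0))"
    proof -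
      have "((1 - e) *\<^sub>R y + e *\<^sub>R x, w') - (x, w0) = (e - 1) *\<^sub>R (- (p - (x, w0)))"
        by (simp add: w'_eq yw algebra_simps)
      then show ?thesis
        using e by (simp only: scaleR_scaleR) simp
    qed
    ultimately show ?thesis
      by simp
  qed
  have scale: "k *\<^sub>R a \<in> Q" if a: "a \<in> Q" for k a
  proof -
    have nonneg: "k *\<^sub>R a \<in> Q" if "0 \<le> k" "a \<in> Q" for k a
      using QE[OF that(2)] that(1) QI by (metis mult_nonneg_nonneg scaleR_scaleR)
    have "- a \<in> Q"
      using QE[OF a] neg nonneg by (metis scaleR_minus_right)
    then show ?thesis
      using nonneg[of k a] nonneg[of "- k" "- a"] a by (cases "0 \<le> k") auto
  qed
  have Q: "subspace Q"
    using zero add scale by (auto simp: subspace_def)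
  have "inj_on fst Q"
  proof (rule inj_onI)
    fix a b assume ab: "a \<in> Q" "b \<in> Q" "fst a = fst b"
    have "a - b \<in> Q"
      using Q ab by (simp add: subspace_diff)
    then obtain r p where rp: "a - b = r *\<^sub>R (p - (x, w0))" "0 \<le> r" "p \<in> Z"
      using QE by blast
    show "a = b"
    proof (cases "r = 0")
      case False
      have "r *\<^sub>R (fst p - x) = 0"
        using rp(1) ab(3) by (metis fst_conv fst_diff fst_scaleR right_minus_eq)
      then have "p = (x, snd p)"
        using False by (simp add: prod_eq_iff)
      then have "snd p = w0"
        using unique w0 rp(3) by metis
      with \<open>p = (x, snd p)\<close> rp(1) show ?thesis
        by simp
    qed (use rp in simp)
  qed
  then obtain g where g: "linear g" "\<And>v. v \<in> Q \<Longrightarrow> g (fst v) = v"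
    using linear_exists_left_inverse_on[OF linear_fst Q] by blast
  show ?thesis
  proof
    show "linear (snd \<circ> g)"
      using g by (intro linear_compose linear_snd)
    then have lin: "linear (\<lambda>z. snd (g z))"
      by (simp add: o_def)
    fix y w assume "(y, w) \<in> Z"
    then have "(y, w) - (x, w0) \<in> Q"
      using QI[of 1 "(y, w)"] by simp
    then have "g (y - x) = (y - x, w - w0)"
      using g(2) by fastforce
    then have "snd (g y) - snd (g x) = w - w0"
      using linear_diff[OF lin, of y x] by simp
    then show "w = (snd \<circ> g) y + (w0 - snd (g x))"
      by (simp add: algebra_simps)
  qed
qed

text \<open>
  The points of the hull on which \<open>f\<close> stays below \<open>m\<close>, together with the hull of the maximum points, form
  a convex set that contains \<open>S\<close>.
\<close>

lemma convex_hull_maximum_set: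
  fixes f :: "'a::real_vector \<Rightarrow> real"
  assumes f: "linear f" and le: "\<And>s. s \<in> S \<Longrightarrow> f s \<le> m"
    and z: "z \<in> convex hull S" and eq: "f z = m"
  shows "z \<in> convex hull {s \<in> S. f s = m}"
proof -
  define T where "T = convex hull {s \<in> S. f s = m}"
  have "convex {z. f z = m}"
    using f by (auto simp: convex_def linear_add linear_scale simp flip: distrib_right)
  then have T: "f a = m" if "a \<in> T" for a
    using that hull_minimal[of "{s \<in> S. f s = m}" "{z. f z = m}" convex] by (auto simp: T_def)
  have "convex ({z. f z < m} \<union> T)"
    unfolding convex_alt
  proof clarify
    fix a b and u :: real
    assume ab: "a \<in> {z. f z < m} \<union> T" "b \<in> {z. f z < m} \<union> T" and u: "0 \<le> u" "u \<le> 1"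
      and notT: "(1 - u) *\<^sub>R a + u *\<^sub>R b \<notin> T"
    have f_le: "f a \<le> m" "f b \<le> m"
      using ab T by force+
    have fu: "f ((1 - u) *\<^sub>R a + u *\<^sub>R b) = (1 - u) * f a + u * f b"
      using f by (simp add: linear_add linear_scale)
    show "f ((1 - u) *\<^sub>R a + u *\<^sub>R b) < m"
    proof (cases "a \<in> T \<and> b \<in> T")
      case True
      then have "(1 - u) *\<^sub>R a + u *\<^sub>R b \<in> T"
        using u unfolding T_def by (intro convexD) auto
      with notT show ?thesis
        by simp
    next
      case False
      have "u \<noteq> 0" if "a \<in> T"
        using that notT by auto
      moreover have "u \<noteq> 1" if "b \<in> T"
        using that notT by auto
      ultimately consider "f a < m" "u < 1" | "f b < m" "0 < u"
        using ab u False notT by fastforce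
      then show ?thesis
      proof cases
        case 1
        then have "(1 - u) * f a < (1 - u) * m" "u * f b \<le> u * m"
          using u f_le by (auto intro: mult_left_mono)
        then show ?thesis
          unfolding fu by (simp add: algebra_simps)
      next
        case 2
        then have "u * f b < u * m" "(1 - u) * f a \<le> (1 - u) * m"
          using u f_le by (auto intro: mult_left_mono)
        then show ?thesis
          unfolding fu by (simp add: algebra_simps)
      qed
    qed
  qed
  moreover have "S \<subseteq> {z. f z < m} \<union> T"
    using le hull_subset[of "{s \<in> S. f s = m}" convex] by (force simp: T_def)
  ultimately have "convex hull S \<subseteq> {z. f z < m} \<union> T"
    by (intro hull_minimal)
  with z eq show ?thesis
    by (auto simp: T_def)
qed

lemma norm_scaleR_sgn: "norm a *\<^sub>R sgn a = (a :: 'a::real_normed_vector)"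
  by (cases "a = 0") (simp_all add: sgn_div_norm)

lemma sgn_difference_ray:
  fixes x y v :: "'a::real_normed_vector"
  assumes "sgn (x - y) = v"
  shows "y = x - norm (x - y) *\<^sub>R v"
  using norm_scaleR_sgn[of "x - y"] assms by simp

lemma inner_eq_one_imp_eq:
  fixes u v :: "'a::real_inner"
  assumes "norm u \<le> 1" "norm v = 1" "v \<bullet> u = 1"
  shows "u = v"
proof -
  have "(norm (u - v))\<^sup>2 = (norm u)\<^sup>2 - 1"
    using assms by (simp add: power2_norm_eq_inner inner_diff_left inner_diff_right inner_commute
        dot_square_norm[of v])
  also have "\<dots> \<le> 0"
    using assms by (simp add: power_le_one)
  finally show ?thesis
    by simp
qed

lemma convex_open_ray: "convex {x - t *\<^sub>R v |t. (0::real) < t}"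
  unfolding convex_def
proof clarsimp
  fix t s a b :: real assume *: "0 < t" "0 < s" "0 \<le> a" "0 \<le> b" "a + b = 1"
  have "a * t + b * s > 0"
    using * by (metis add_cancel_right_right add_nonneg_pos add_pos_nonneg less_eq_real_def
        mult_nonneg_nonneg mult_pos_pos zero_less_one)
  moreover have "a *\<^sub>R (x - t *\<^sub>R v) + b *\<^sub>R (x - s *\<^sub>R v) = x - (a * t + b * s) *\<^sub>R v"
    using * by (simp add: algebra_simps flip: scaleR_add_left)
  ultimately show "\<exists>r. a *\<^sub>R (x - t *\<^sub>R v) + b *\<^sub>R (x - s *\<^sub>R v) = x - r *\<^sub>R v \<and> 0 < r"
    by blast
qed

text \<open>
  The map \<open>L\<close> is \<open>y \<mapsto> sgn (x - y)\<close> on the closure of \<open>S\<close>, hence of norm one there and of norm at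
  most one on the hull. By strict convexity of the ball, a point of the hull where \<open>L\<close> equals a
  unit vector \<open>v\<close> is a convex combination of points with that same direction, so it lies on the open
  ray from \<open>x\<close> in direction \<open>- v\<close>. This has two uses. It gives \<open>norm (L x) \<noteq> 1\<close>, because \<open>x\<close> does not lie
  on a ray that starts at \<open>x\<close> and excludes it; in particular \<open>x\<close> is not in the closure of \<open>S\<close>. And if a
  point of the closure were inside a segment of the hull, both ends would be on one such ray, \<open>L\<close> would
  be constant on its line, and \<open>L x\<close> would be a unit vector after all.
\<close>

lemma extreme_points_of_affine_directions:
  fixes S :: "'a::euclidean_space set"
  assumes A: "linear A" and dir: "\<And>y. y \<in> S \<Longrightarrow> A y + c = sgn (x - y)"
    and x: "x \<in> convex hull S" "x \<notin> S"
  shows "closure S = Ext (convex hull (closure S))"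
proof -
  define L where "L y = A y + c" for y
  have cont: "continuous_on UNIV L"
    unfolding L_def using A by (intro continuous_intros linear_continuous_on) (simp add: linear_conv_bounded_linear)
  have Lcomb: "L (a *\<^sub>R y + b *\<^sub>R z) = a *\<^sub>R L y + b *\<^sub>R L z" if "a + b = 1" for a b y z
  proof -
    have "a *\<^sub>R L y + b *\<^sub>R L z = A (a *\<^sub>R y + b *\<^sub>R z) + (a + b) *\<^sub>R c"
      using A by (simp add: L_def linear_add linear_scale algebra_simps)
    then show ?thesis
      using that by (simp add: L_def)
  qed
  have ball: "norm (L y) \<le> 1" if "\<And>y. y \<in> T \<Longrightarrow> norm (L y) = 1" "y \<in> convex hull T" for y T
  proof -
    have "convex {y. norm (L y) \<le> 1}"
      unfolding convex_def
    proof clarsimp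
      fix y z and a b :: real
      assume *: "norm (L y) \<le> 1" "norm (L z) \<le> 1" "0 \<le> a" "0 \<le> b" "a + b = 1"
      have "L (a *\<^sub>R y + b *\<^sub>R z) \<in> cball 0 1"
        unfolding Lcomb[OF *(5)] using * by (intro convexD) auto
      then show "norm (L (a *\<^sub>R y + b *\<^sub>R z)) \<le> 1"
        by simp
    qed
    then show ?thesis
      using that hull_minimal[of T "{y. norm (L y) \<le> 1}" convex] by fastforce
  qed
  have ray: "z \<in> {x - t *\<^sub>R v |t. 0 < t}"
    if T: "\<And>y. y \<in> T \<Longrightarrow> L y = sgn (x - y)" "x \<notin> T" and z: "z \<in> convex hull T"
      and v: "L z = v" "norm v = 1" for z v T
  proof -
    have lin: "linear (\<lambda>y. v \<bullet> A y)"
      using A by (simp add: linear_iff inner_add_right)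
    have unit: "norm (L y) = 1" if "y \<in> T" for y
      using T that by (auto simp: norm_sgn)
    have vL: "v \<bullet> L y = v \<bullet> A y + v \<bullet> c" for y
      by (simp add: L_def inner_add_right)
    have "z \<in> convex hull {y \<in> T. v \<bullet> A y = 1 - v \<bullet> c}"
    proof (rule convex_hull_maximum_set[OF lin _ z])
      fix y assume "y \<in> T"
      have "v \<bullet> L y \<le> 1"
        using norm_cauchy_schwarz[of v "L y"] v unit[OF \<open>y \<in> T\<close>] by simp
      then show "v \<bullet> A y \<le> 1 - v \<bullet> c"
        using vL[of y] by linarith
    next
      have "v \<bullet> L z = 1"
        using v by (simp add: dot_square_norm)
      then show "v \<bullet> A z = 1 - v \<bullet> c"
        using vL[of z] by linarith
    qed
    moreover have "{y \<in> T. v \<bullet> A y = 1 - v \<bullet> c} \<subseteq> {x - t *\<^sub>R v |t. 0 < t}"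
    proof
      fix y assume "y \<in> {y \<in> T. v \<bullet> A y = 1 - v \<bullet> c}"
      then have y: "y \<in> T" "v \<bullet> A y = 1 - v \<bullet> c"
        by simp_all
      have "v \<bullet> L y = 1"
        using y(2) vL[of y] by linarith
      then have "L y = v"
        using unit[OF y(1)] v(2) by (metis inner_eq_one_imp_eq order_refl)
      then have "y = x - norm (x - y) *\<^sub>R v"
        using T(1)[OF y(1)] by (metis sgn_difference_ray)
      moreover have "norm (x - y) > 0"
        using T(2) y(1) by auto
      ultimately show "y \<in> {x - t *\<^sub>R v |t. 0 < t}"
        by blast
    qed
    then have "convex hull {y \<in> T. v \<bullet> A y = 1 - v \<bullet> c} \<subseteq> {x - t *\<^sub>R v |t. 0 < t}"
      by (rule hull_minimal) (rule convex_open_ray)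
    ultimately show ?thesis
      by blast
  qed
  have Lx: "norm (L x) \<noteq> 1"
  proof
    assume "norm (L x) = 1"
    then have "x \<in> {x - t *\<^sub>R L x |t. 0 < t}"
      using ray[of S x "L x"] dir x by (auto simp: L_def)
    with \<open>norm (L x) = 1\<close> show False
      by (auto simp: algebra_simps)
  qed
  have "S \<subseteq> {y. norm (L y) = 1}"
    using dir x(2) by (auto simp: L_def norm_sgn)
  moreover have "closed {y. norm (L y) = 1}"
    using cont by (intro closed_Collect_eq continuous_intros) auto
  ultimately have "closure S \<subseteq> {y. norm (L y) = 1}"
    by (rule closure_minimal)
  then have unit: "norm (L y) = 1" if "y \<in> closure S" for y
    using that by blast
  then have xS: "x \<notin> closure S"
    using Lx by blast
  have cl_scaled: "closure S \<subseteq> {y. norm (x - y) *\<^sub>R L y = x - y}"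
  proof (rule closure_minimal)
    show "S \<subseteq> {y. norm (x - y) *\<^sub>R L y = x - y}"
      using dir by (auto simp: L_def norm_scaleR_sgn)
    show "closed {y. norm (x - y) *\<^sub>R L y = x - y}"
      using cont by (intro closed_Collect_eq continuous_intros) auto
  qed
  have cl: "L y = sgn (x - y)" if "y \<in> closure S" for y
  proof -
    have "norm (x - y) *\<^sub>R L y = norm (x - y) *\<^sub>R sgn (x - y)" "norm (x - y) \<noteq> 0"
      using cl_scaled that xS by (auto simp: norm_scaleR_sgn)
    then show ?thesis
      by simp
  qed
  have "y extreme_point_of (convex hull (closure S))" if y: "y \<in> closure S" for y
    unfolding extreme_point_of_def
  proof (intro conjI ballI)
    show "y \<in> convex hull (closure S)"
      using y by (rule hull_inc)
    fix a b assume ab: "a \<in> convex hull (closure S)" "b \<in> convex hull (closure S)"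
    show "y \<notin> open_segment a b"
    proof
      assume "y \<in> open_segment a b"
      then obtain u where u: "0 < u" "u < 1" "y = (1 - u) *\<^sub>R a + u *\<^sub>R b" and "a \<noteq> b"
        by (auto simp: in_segment)
      define v where "v = L y"
      have v: "norm v = 1"
        using unit y by (simp add: v_def)
      have La: "norm (L a) \<le> 1" and Lb: "norm (L b) \<le> 1"
        using ball[of "closure S"] unit ab by auto
      have vy: "v = (1 - u) *\<^sub>R L a + u *\<^sub>R L b"
        using Lcomb[of "1 - u" u a b] u by (simp add: v_def)
      have le: "v \<bullet> L a \<le> 1" "v \<bullet> L b \<le> 1"
        using norm_cauchy_schwarz[of v "L a"] norm_cauchy_schwarz[of v "L b"] v La Lb by auto
      have sum: "(1 - u) * (1 - v \<bullet> L a) + u * (1 - v \<bullet> L b) = 0"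
      proof -
        have "v \<bullet> v = v \<bullet> ((1 - u) *\<^sub>R L a + u *\<^sub>R L b)"
          using vy by simp
        then have "1 = (1 - u) * (v \<bullet> L a) + u * (v \<bullet> L b)"
          using v by (simp add: inner_add_right dot_square_norm)
        then show ?thesis
          by (simp add: algebra_simps)
      qed
      have "0 \<le> (1 - u) * (1 - v \<bullet> L a)" "0 \<le> u * (1 - v \<bullet> L b)"
        using u le by simp_all
      then have "(1 - u) * (1 - v \<bullet> L a) = 0" "u * (1 - v \<bullet> L b) = 0"
        using sum by linarith+
      then have "v \<bullet> L a = 1" "v \<bullet> L b = 1"
        using u by auto
      then have "L a = v" "L b = v"
        using La Lb v inner_eq_one_imp_eq by blast+
      then obtain s t where st: "a = x - s *\<^sub>R v" "b = x - t *\<^sub>R v"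
        using ray[of "closure S" a v] ray[of "closure S" b v] cl xS ab v by blast
      then have "s \<noteq> t"
        using \<open>a \<noteq> b\<close> by auto
      \<comment> \<open>the coefficients that express \<open>x\<close> as an affine combination of the two points of the ray\<close>
      define p q where "p = t / (t - s)" and "q = - s / (t - s)"
      have pq: "p + q = 1"
        using \<open>s \<noteq> t\<close> by (simp add: p_def q_def flip: diff_divide_distrib)
      have "p * s + q * t = 0"
        by (simp add: p_def q_def)
      moreover have "p *\<^sub>R a + q *\<^sub>R b = (p + q) *\<^sub>R x - (p * s + q * t) *\<^sub>R v"
        by (simp add: st algebra_simps)
      ultimately have "x = p *\<^sub>R a + q *\<^sub>R b"
        using pq by simp
      then have "L x = (p + q) *\<^sub>R v"
        using Lcomb[OF pq, of a b] \<open>L a = v\<close> \<open>L b = v\<close> by (simp add: scaleR_add_left)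
      then have "L x = v"
        unfolding pq by simp
      with v Lx show False
        by simp
    qed
  qed
  then show ?thesis
    using extreme_point_of_convex_hull by (auto simp: Ext_def)
qed

section \<open>Regularity of contact layers at almost every point\<close>

text \<open>
  The norm lies above its tangent at \<open>a\<close> by convexity; the upper bound is the inequality between
  the geometric and arithmetic means of \<open>norm (a + d)\<close> and \<open>norm a\<close>.
\<close>

lemma norm_add_tangent_bounds:
  fixes a d :: "'a::real_inner"
  assumes "a \<noteq> 0"
  shows "0 \<le> norm (a + d) - norm a - sgn a \<bullet> d"
    and "norm (a + d) - norm a - sgn a \<bullet> d \<le> (norm d)\<^sup>2 / (2 * norm a)"
proof -
  have na: "norm a > 0"
    using assms by simp
  have sgn: "sgn a \<bullet> d = (a \<bullet> d) / norm a"
    by (simp add: sgn_div_norm divide_inverse mult.commute)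
  have "norm a * (norm a + sgn a \<bullet> d) = a \<bullet> (a + d)"
    using na by (simp add: sgn inner_add_right algebra_simps power2_norm_eq_inner flip: power2_eq_square)
  also have "\<dots> \<le> norm a * norm (a + d)"
    by (rule norm_cauchy_schwarz)
  finally show "0 \<le> norm (a + d) - norm a - sgn a \<bullet> d"
    using na by simp
  have sq: "(norm (a + d))\<^sup>2 = (norm a)\<^sup>2 + 2 * (a \<bullet> d) + (norm d)\<^sup>2"
    by (simp add: power2_norm_eq_inner inner_add_left inner_add_right inner_commute)
  have "0 \<le> (norm (a + d) - norm a)\<^sup>2"
    by simp
  then have "2 * norm a * norm (a + d) \<le> 2 * (norm a)\<^sup>2 + 2 * (a \<bullet> d) + (norm d)\<^sup>2"
    by (simp add: power2_diff sq algebra_simps)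
  then show "norm (a + d) - norm a - sgn a \<bullet> d \<le> (norm d)\<^sup>2 / (2 * norm a)"
    unfolding sgn using na
    by (subst pos_le_divide_eq) (simp_all add: power2_eq_square algebra_simps)
qed

definition direction_graph :: "'a::euclidean_space set \<Rightarrow> 'a \<Rightarrow> ('a \<times> 'a) set" where
  "direction_graph S x = convex hull ((\<lambda>y. (y, sgn (x - y))) ` S)"

text \<open>
  Points of the section at distance at least \<open>1 / (2 * n)\<close> from \<open>x\<close>: by
  \<open>norm_add_tangent_bounds\<close>, the error of replacing their distance functions by the tangents at \<open>x\<close> is
  at most \<open>n\<close> times the squared displacement.
\<close>

definition separated_section :: "('a::euclidean_space \<times> 'a) set \<Rightarrow> nat \<Rightarrow> 'a \<Rightarrow> 'a set" where
  "separated_section \<Gamma> n x = {y. (x, y) \<in> \<Gamma> \<and> 1 \<le> 2 * real n * norm (x - y)}"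

lemma direction_graph_separated_mono:
  assumes "n \<le> m"
  shows "direction_graph (separated_section \<Gamma> n x) x \<subseteq> direction_graph (separated_section \<Gamma> m x) x"
proof -
  have "1 \<le> 2 * real m * norm (x - y)" if "1 \<le> 2 * real n * norm (x - y)" for y
    using mult_right_mono[of "2 * real n" "2 * real m" "norm (x - y)"] assms that by simp
  then have "separated_section \<Gamma> n x \<subseteq> separated_section \<Gamma> m x"
    by (auto simp: separated_section_def)
  then show ?thesis
    unfolding direction_graph_def by (intro hull_mono image_mono)
qed

text \<open>
  The separated sections exhaust a section that omits \<open>x\<close>, and an increasing union of convex sets is
  convex.
\<close>

lemma direction_graph_Union_separated:
  assumes "x \<notin> \<Gamma> `` {x}"
  shows "direction_graph (\<Gamma> `` {x}) x \<subseteq> (\<Union>n. direction_graph (separated_section \<Gamma> n x) x)"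
  unfolding direction_graph_def[of "\<Gamma> `` {x}"]
proof (rule hull_minimal)
  show "(\<lambda>y. (y, sgn (x - y))) ` (\<Gamma> `` {x}) \<subseteq> (\<Union>n. direction_graph (separated_section \<Gamma> n x) x)"
  proof clarify
    fix y assume y: "(x, y) \<in> \<Gamma>"
    then have "norm (x - y) > 0"
      using assms by auto
    obtain n :: nat where "1 / (2 * norm (x - y)) \<le> real n"
      using real_arch_simple by blast
    then have "y \<in> separated_section \<Gamma> n x"
      using y \<open>norm (x - y) > 0\<close> by (simp add: separated_section_def field_simps)
    then show "(y, sgn (x - y)) \<in> (\<Union>n. direction_graph (separated_section \<Gamma> n x) x)"
      by (auto simp: direction_graph_def intro: hull_inc)
  qed
  note mono = direction_graph_separated_mono[of _ _ \<Gamma> x]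
  show "convex (\<Union>n. direction_graph (separated_section \<Gamma> n x) x)"
  proof (rule convexI)
    fix p q and u v :: real
    assume "p \<in> (\<Union>n. direction_graph (separated_section \<Gamma> n x) x)"
      "q \<in> (\<Union>n. direction_graph (separated_section \<Gamma> n x) x)" and uv: "0 \<le> u" "0 \<le> v" "u + v = 1"
    then obtain n m where "p \<in> direction_graph (separated_section \<Gamma> n x) x"
      "q \<in> direction_graph (separated_section \<Gamma> m x) x"
      by blast
    then have "p \<in> direction_graph (separated_section \<Gamma> (max n m) x) x"
      "q \<in> direction_graph (separated_section \<Gamma> (max n m) x) x"
      using mono[of n "max n m"] mono[of m "max n m"] by auto
    then have "u *\<^sub>R p + v *\<^sub>R q \<in> direction_graph (separated_section \<Gamma> (max n m) x) x"
      using uv unfolding direction_graph_def by (intro convexD convex_convex_hull)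
    then show "u *\<^sub>R p + v *\<^sub>R q \<in> (\<Union>n. direction_graph (separated_section \<Gamma> n x) x)"
      by blast
  qed
qed

text \<open>
  The sign \<open>s\<close> unites the maximization case (\<open>s = 1\<close>) and the minimization case (\<open>s = - 1\<close>).
\<close>

locale signed_contact_layer =
  fixes \<Gamma> :: "('a::euclidean_space \<times> 'a) set" and \<alpha> :: "'a \<Rightarrow> real" and \<gamma> :: "'a \<Rightarrow> 'a"
    and \<beta> :: "'a \<Rightarrow> real" and s :: real
  assumes sign: "s = 1 \<or> s = - 1"
    and ineq: "\<And>x y. x \<in> Domain \<Gamma> \<Longrightarrow> y \<in> Range \<Gamma> \<Longrightarrow>
      0 \<le> s * (\<beta> y - \<alpha> x - \<gamma> x \<bullet> (y - x) - norm (x - y))"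
    and contact: "\<And>x y. (x, y) \<in> \<Gamma> \<Longrightarrow> \<beta> y - \<alpha> x - \<gamma> x \<bullet> (y - x) = norm (x - y)"
    and centred: "\<And>x. x \<in> Domain \<Gamma> \<Longrightarrow> x \<in> IC (\<Gamma> `` {x})"
begin

text \<open>
  The inequality for the base point \<open>x'\<close> minus the equality for the base point \<open>x\<close>, both at the
  target \<open>y\<close>; this eliminates \<open>\<beta>\<close>. The first two terms are affine in \<open>y\<close>, which is what
  allows averaging over \<open>y\<close> once the distances have been linearized.
\<close>

lemma contact_comparison:
  assumes "(x, y) \<in> \<Gamma>" "x' \<in> Domain \<Gamma>"
  shows "0 \<le> s * ((\<alpha> x + \<gamma> x \<bullet> (y - x)) - (\<alpha> x' + \<gamma> x' \<bullet> (y - x')) - (norm (x' - y) - norm (x - y)))"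
proof -
  have "y \<in> Range \<Gamma>"
    using assms by auto
  from ineq[OF assms(2) this] have "0 \<le> s * (\<beta> y - \<alpha> x' - \<gamma> x' \<bullet> (y - x') - norm (x' - y))" .
  also have "\<beta> y - \<alpha> x' - \<gamma> x' \<bullet> (y - x') - norm (x' - y)
      = (\<alpha> x + \<gamma> x \<bullet> (y - x)) - (\<alpha> x' + \<gamma> x' \<bullet> (y - x')) - (norm (x' - y) - norm (x - y))"
    using contact[OF assms(1)] by linarith
  finally show ?thesis .
qed

lemma contact_comparison_separated:
  assumes y: "y \<in> separated_section \<Gamma> n x" and x': "x' \<in> Domain \<Gamma>"
  shows "- (real n * (norm (x' - x))\<^sup>2)
    \<le> s * ((\<alpha> x + \<gamma> x \<bullet> (y - x)) - (\<alpha> x' + \<gamma> x' \<bullet> (y - x')) - sgn (x - y) \<bullet> (x' - x))"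
proof -
  have xy: "(x, y) \<in> \<Gamma>" and sep: "1 \<le> 2 * real n * norm (x - y)"
    using y by (auto simp: separated_section_def)
  have "x - y \<noteq> 0"
    using sep by auto
  let ?err = "norm (x' - y) - norm (x - y) - sgn (x - y) \<bullet> (x' - x)"
  have err: "0 \<le> ?err" "?err \<le> (norm (x' - x))\<^sup>2 / (2 * norm (x - y))"
    using norm_add_tangent_bounds[OF \<open>x - y \<noteq> 0\<close>, of "x' - x"] by (simp_all add: algebra_simps)
  have "(norm (x' - x))\<^sup>2 / (2 * norm (x - y)) \<le> real n * (norm (x' - x))\<^sup>2"
  proof -
    have "1 / (2 * norm (x - y)) \<le> real n"
      using sep \<open>x - y \<noteq> 0\<close> by (simp add: field_simps)
    from mult_right_mono[OF this, of "(norm (x' - x))\<^sup>2"] show ?thesis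
      by simp
  qed
  then have "\<bar>s * ?err\<bar> \<le> real n * (norm (x' - x))\<^sup>2"
    using sign err by auto
  moreover have "s * ((\<alpha> x + \<gamma> x \<bullet> (y - x)) - (\<alpha> x' + \<gamma> x' \<bullet> (y - x')) - sgn (x - y) \<bullet> (x' - x))
      = s * ((\<alpha> x + \<gamma> x \<bullet> (y - x)) - (\<alpha> x' + \<gamma> x' \<bullet> (y - x')) - (norm (x' - y) - norm (x - y))) + s * ?err"
    by (simp add: algebra_simps)
  ultimately show ?thesis
    using contact_comparison[OF xy x'] by linarith
qed

text \<open>
  The comparison is a half-space condition on the pair \<open>(y, sgn (x - y))\<close>, so it passes to the convex
  hull of such pairs and can be evaluated at a pair with first component \<open>x\<close>.
\<close>

lemma contact_comparison_centre:
  assumes w: "(x, w) \<in> direction_graph (separated_section \<Gamma> n x) x" and x': "x' \<in> Domain \<Gamma>"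
  shows "- (real n * (norm (x' - x))\<^sup>2) \<le> s * (\<alpha> x - \<alpha> x' + \<gamma> x' \<bullet> (x' - x) - w \<bullet> (x' - x))"
proof -
  define H where "H = {p. - (real n * (norm (x' - x))\<^sup>2)
    \<le> s * ((\<alpha> x + \<gamma> x \<bullet> (fst p - x)) - (\<alpha> x' + \<gamma> x' \<bullet> (fst p - x')) - snd p \<bullet> (x' - x))}"
  have "H = {p. (s *\<^sub>R (\<gamma> x' - \<gamma> x), s *\<^sub>R (x' - x)) \<bullet> p
      \<le> real n * (norm (x' - x))\<^sup>2 + s * (\<alpha> x - \<gamma> x \<bullet> x - \<alpha> x' + \<gamma> x' \<bullet> x')}"
    by (auto simp: H_def inner_prod_def inner_diff_left inner_diff_right inner_commute algebra_simps)
  then have "convex H"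
    using convex_halfspace_le by metis
  moreover have "(\<lambda>y. (y, sgn (x - y))) ` separated_section \<Gamma> n x \<subseteq> H"
    using contact_comparison_separated[OF _ x'] by (auto simp: H_def)
  ultimately have "direction_graph (separated_section \<Gamma> n x) x \<subseteq> H"
    unfolding direction_graph_def by (intro hull_minimal)
  then have "(x, w) \<in> H"
    using w by blast
  then show ?thesis
    by (simp add: H_def inner_diff_right algebra_simps)
qed

text \<open>
  Adding \<open>contact_comparison_centre\<close> for \<open>x\<close> and \<open>y\<close> to the same inequality with the roles of
  \<open>x\<close> and \<open>y\<close> interchanged cancels \<open>\<alpha>\<close>; the multiple of the identity absorbs the two quadratic errors.
\<close>

lemma monotone_relation_centre:
  "monotone_relation {(x, t). x \<in> Domain \<Gamma> \<and>
     (\<exists>w. (x, w) \<in> direction_graph (separated_section \<Gamma> n x) x \<and>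
       t = s *\<^sub>R (\<gamma> x + w) + (2 * real n) *\<^sub>R x)}"
  (is "monotone_relation ?M")
proof (rule monotone_relationI)
  fix x t y t' assume "(x, t) \<in> ?M" "(y, t') \<in> ?M"
  then obtain w v where
      x: "x \<in> Domain \<Gamma>" "(x, w) \<in> direction_graph (separated_section \<Gamma> n x) x"
    and y: "y \<in> Domain \<Gamma>" "(y, v) \<in> direction_graph (separated_section \<Gamma> n y) y"
    and t: "t = s *\<^sub>R (\<gamma> x + w) + (2 * real n) *\<^sub>R x" "t' = s *\<^sub>R (\<gamma> y + v) + (2 * real n) *\<^sub>R y"
    by blast
  have "- (real n * (norm (y - x))\<^sup>2) \<le> s * (\<alpha> x - \<alpha> y + \<gamma> y \<bullet> (y - x) - w \<bullet> (y - x))"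
    by (rule contact_comparison_centre[OF x(2) y(1)])
  moreover have "- (real n * (norm (y - x))\<^sup>2) \<le> s * (\<alpha> y - \<alpha> x + \<gamma> x \<bullet> (x - y) - v \<bullet> (x - y))"
    using contact_comparison_centre[OF y(2) x(1)] by (simp add: norm_minus_commute)
  ultimately have "0 \<le> s * (\<alpha> x - \<alpha> y + \<gamma> y \<bullet> (y - x) - w \<bullet> (y - x))
      + s * (\<alpha> y - \<alpha> x + \<gamma> x \<bullet> (x - y) - v \<bullet> (x - y)) + 2 * real n * (norm (y - x))\<^sup>2"
    by linarith
  also have "\<dots> = (t - t') \<bullet> (x - y)"
    by (simp add: t power2_norm_eq_inner inner_diff_left inner_diff_right inner_add_left inner_commute algebra_simps)
  finally show "0 \<le> (t - t') \<bullet> (x - y)" .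
qed

text \<open>
  At a diagonal contact the target of the comparison is the base point itself, where the distance
  function has a kink. Two comparisons give \<open>2 * norm (x - y) \<le> (\<gamma> x - \<gamma> y) \<bullet> (x - y)\<close>, so that
  \<open>\<gamma>\<close> remains monotone after arbitrary perturbations from the unit ball.
\<close>

lemma negligible_diagonal:
  assumes "s = 1"
  shows "negligible {x. (x, x) \<in> \<Gamma>}"
proof -
  define M where "M = {(x, \<gamma> x + w) |x w. (x, x) \<in> \<Gamma> \<and> norm w \<le> 1}"
  have "monotone_relation M"
    unfolding monotone_relation_def M_def
  proof clarsimp
    fix x y w v :: 'a assume x: "(x, x) \<in> \<Gamma>" "norm w \<le> 1" and y: "(y, y) \<in> \<Gamma>" "norm v \<le> 1"
    have "0 \<le> \<alpha> x - (\<alpha> y + \<gamma> y \<bullet> (x - y)) - norm (y - x)"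
      "0 \<le> \<alpha> y - (\<alpha> x + \<gamma> x \<bullet> (y - x)) - norm (y - x)"
      using contact_comparison[OF x(1), of y] contact_comparison[OF y(1), of x] x y assms
      by (auto simp: norm_minus_commute)
    then have "2 * norm (x - y) \<le> (\<gamma> x - \<gamma> y) \<bullet> (x - y)"
      by (simp add: norm_minus_commute inner_diff_left inner_diff_right)
    moreover have "\<bar>(w - v) \<bullet> (x - y)\<bar> \<le> 2 * norm (x - y)"
    proof -
      have "norm (w - v) \<le> 2"
        using norm_triangle_ineq4[of w v] x y by simp
      then show ?thesis
        using Cauchy_Schwarz_ineq2[of "w - v" "x - y"] mult_right_mono[of "norm (w - v)" 2 "norm (x - y)"]
        by simp
    qed
    moreover have "(\<gamma> x + w - (\<gamma> y + v)) \<bullet> (x - y) = (\<gamma> x - \<gamma> y) \<bullet> (x - y) + (w - v) \<bullet> (x - y)"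
      by (simp add: inner_diff_left inner_add_left)
    ultimately show "0 \<le> (\<gamma> x + w - (\<gamma> y + v)) \<bullet> (x - y)"
      by linarith
  qed
  note negligible_multivalued_of_monotone_relation[OF this]
  moreover have "{x. (x, x) \<in> \<Gamma>} \<subseteq> {x. \<exists>t t'. (x, t) \<in> M \<and> (x, t') \<in> M \<and> t \<noteq> t'}"
  proof clarify
    fix x assume x: "(x, x) \<in> \<Gamma>"
    obtain e :: 'a where e: "e \<in> Basis"
      using nonempty_Basis by blast
    have "(x, \<gamma> x + 0) \<in> M" "(x, \<gamma> x + e) \<in> M"
      unfolding M_def using x e by fastforce+
    moreover have "\<gamma> x + 0 \<noteq> \<gamma> x + e"
      using e nonzero_Basis by auto
    ultimately show "\<exists>t t'. (x, t) \<in> M \<and> (x, t') \<in> M \<and> t \<noteq> t'"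
      by blast
  qed
  ultimately show ?thesis
    by (rule negligible_subset)
qed

text \<open>
  Off a null set, the convex hull of the pairs \<open>(y, sgn (x - y))\<close> has a single point above \<open>x\<close>:
  two of them would give two values of one of the monotone relations \<open>M k\<close>. The hull is then the graph
  of an affine map, and \<open>extreme_points_of_affine_directions\<close> applies.
\<close>

lemma negligible_not_extreme:
  assumes off_diagonal: "s = - 1 \<Longrightarrow> \<forall>x. (x, x) \<notin> \<Gamma>"
  shows "negligible {x \<in> Domain \<Gamma>. closure (\<Gamma> `` {x}) \<noteq> Ext (convex hull (closure (\<Gamma> `` {x})))}"
proof -
  define M where "M n = {(x, t). x \<in> Domain \<Gamma> \<and>
     (\<exists>w. (x, w) \<in> direction_graph (separated_section \<Gamma> n x) x \<and>
       t = s *\<^sub>R (\<gamma> x + w) + (2 * real n) *\<^sub>R x)}" for n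
  define N where "N n = {x. \<exists>t t'. (x, t) \<in> M n \<and> (x, t') \<in> M n \<and> t \<noteq> t'}" for n
  have "negligible {x. (x, x) \<in> \<Gamma>}"
    using sign negligible_diagonal off_diagonal by (cases "s = 1") auto
  moreover have "negligible (N n)" for n
    unfolding N_def M_def by (intro negligible_multivalued_of_monotone_relation monotone_relation_centre)
  ultimately have "negligible ({x. (x, x) \<in> \<Gamma>} \<union> (\<Union>n. N n))"
    by (intro negligible_Un negligible_Union_nat)
  moreover have "closure (\<Gamma> `` {x}) = Ext (convex hull (closure (\<Gamma> `` {x})))"
    if x: "x \<in> Domain \<Gamma>" and diag: "(x, x) \<notin> \<Gamma>" and N: "x \<notin> (\<Union>n. N n)" for x
  proof -
    let ?Z = "direction_graph (\<Gamma> `` {x}) x"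
    have conv: "convex ?Z"
      by (simp add: direction_graph_def)
    have "fst ` ?Z = convex hull (\<Gamma> `` {x})"
      unfolding direction_graph_def by (simp add: linear_fst image_image convex_hull_linear_image)
    then have "x \<in> rel_interior (fst ` ?Z)"
      using centred[OF x] by (simp add: IC_def)
    moreover have "w = v" if wv: "(x, w) \<in> ?Z" "(x, v) \<in> ?Z" for w v
    proof (rule ccontr)
      assume "w \<noteq> v"
      have diag': "x \<notin> \<Gamma> `` {x}"
        using diag by simp
      obtain n m where nm: "(x, w) \<in> direction_graph (separated_section \<Gamma> n x) x"
        "(x, v) \<in> direction_graph (separated_section \<Gamma> m x) x"
        using wv direction_graph_Union_separated[OF diag'] by blast
      define k where "k = max n m"
      have k: "(x, w) \<in> direction_graph (separated_section \<Gamma> k x) x"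
        "(x, v) \<in> direction_graph (separated_section \<Gamma> k x) x"
        using nm direction_graph_separated_mono[of n k \<Gamma> x] direction_graph_separated_mono[of m k \<Gamma> x]
        by (auto simp: k_def)
      have "(x, s *\<^sub>R (\<gamma> x + w) + (2 * real k) *\<^sub>R x) \<in> M k" "(x, s *\<^sub>R (\<gamma> x + v) + (2 * real k) *\<^sub>R x) \<in> M k"
        using k x by (auto simp: M_def)
      moreover have "s *\<^sub>R (\<gamma> x + w) + (2 * real k) *\<^sub>R x \<noteq> s *\<^sub>R (\<gamma> x + v) + (2 * real k) *\<^sub>R x"
        using \<open>w \<noteq> v\<close> sign by auto
      ultimately have "x \<in> N k"
        unfolding N_def by blast
      with N show False
        by blast
    qed
    ultimately obtain A c where A: "linear A" "\<And>y w. (y, w) \<in> ?Z \<Longrightarrow> w = A y + c"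
      using affine_extension_of_graph[OF conv] by metis
    show ?thesis
    proof (rule extreme_points_of_affine_directions[OF A(1)])
      show "A y + c = sgn (x - y)" if "y \<in> \<Gamma> `` {x}" for y
      proof -
        have "(y, sgn (x - y)) \<in> ?Z"
          unfolding direction_graph_def using that by (auto intro!: hull_inc)
        then show ?thesis
          using A(2) by simp
      qed
      show "x \<in> convex hull (\<Gamma> `` {x})"
        using centred[OF x] rel_interior_subset by (auto simp: IC_def)
    qed (use diag in simp)
  qed
  ultimately show ?thesis
    by (elim negligible_subset) blast
qed

end

section \<open>Integration along a disintegration\<close>

context
  fixes \<mu> :: "'a::euclidean_space measure" and \<pi> :: "('a \<times> 'a) measure" and \<kappa> :: "'a \<Rightarrow> 'a measure"
  assumes sets_mu: "sets \<mu> = sets borel" and sets_pi: "sets \<pi> = sets borel"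
    and disint: "disintegration \<mu> \<pi> \<kappa>"
begin

lemma disintegration_kernel [measurable]: "\<kappa> \<in> measurable \<mu> (subprob_algebra borel)"
  using disint by (auto simp: disintegration_def intro: measurable_prob_algebraD)

lemma disintegration_section: "prob_space (\<kappa> x)" "sets (\<kappa> x) = sets borel"
proof -
  have "\<kappa> x \<in> space (prob_algebra borel)"
    using disint sets_eq_imp_space_eq[OF sets_mu]
    by (auto simp: disintegration_def dest: measurable_space[of _ _ _ x])
  then show "prob_space (\<kappa> x)" "sets (\<kappa> x) = sets borel"
    by (simp_all add: space_prob_algebra)
qed

lemma sets_pair_borel: "sets (\<mu> \<Otimes>\<^sub>M borel) = sets (borel :: ('a \<times> 'a) measure)"
  using sets_mu by (simp add: borel_prod[symmetric] cong: sets_pair_measure_cong)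

lemma fibre_kernel: "(\<lambda>x. distr (\<kappa> x) borel (Pair x)) \<in> measurable \<mu> (subprob_algebra borel)"
  by (rule measurable_distr2[OF _ disintegration_kernel]) (simp add: sets_pair_borel cong: measurable_cong_sets)

lemma disintegration_nn_integral_section_measurable:
  assumes f: "f \<in> borel_measurable borel"
  shows "(\<lambda>x. \<integral>\<^sup>+y. f (x, y) \<partial>\<kappa> x) \<in> borel_measurable \<mu>"
  using f
  by (intro nn_integral_measurable_subprob_algebra2[OF _ disintegration_kernel])
     (simp add: sets_pair_borel cong: measurable_cong_sets)

text \<open>
  The plan is the bind of \<open>\<mu>\<close> with the kernel that places \<open>\<kappa> x\<close> on the fibre over \<open>x\<close>.
\<close>

lemma disintegration_nn_integral:
  assumes f: "f \<in> borel_measurable borel"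
  shows "(\<integral>\<^sup>+p. f p \<partial>\<pi>) = (\<integral>\<^sup>+x. \<integral>\<^sup>+y. f (x, y) \<partial>\<kappa> x \<partial>\<mu>)"
proof -
  have space: "space \<mu> = UNIV" "space \<pi> = UNIV"
    using sets_eq_imp_space_eq[OF sets_mu] sets_eq_imp_space_eq[OF sets_pi] by simp_all
  define N where "N x = distr (\<kappa> x) borel (Pair x)" for x
  have N: "N \<in> measurable \<mu> (subprob_algebra borel)"
    unfolding N_def by (rule fibre_kernel)
  have Pair: "Pair x \<in> measurable (\<kappa> x) borel" for x
    using disintegration_section by (simp cong: measurable_cong_sets)
  have "\<pi> = \<mu> \<bind> N"
  proof (rule measure_eqI)
    show "sets \<pi> = sets (\<mu> \<bind> N)"
      using space by (simp add: sets_pi sets_bind[OF sets_kernel[OF N]])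
    fix A assume "A \<in> sets \<pi>"
    then have A: "A \<in> sets borel"
      by (simp add: sets_pi)
    have "emeasure (N x) A = emeasure (\<kappa> x) {y. (x, y) \<in> A}" for x
      using sets_eq_imp_space_eq[OF disintegration_section(2)] A Pair
      by (simp add: N_def emeasure_distr vimage_def)
    then show "emeasure \<pi> A = emeasure (\<mu> \<bind> N) A"
      using disint A N space by (simp add: emeasure_bind disintegration_def)
  qed
  then have "(\<integral>\<^sup>+p. f p \<partial>\<pi>) = (\<integral>\<^sup>+x. \<integral>\<^sup>+p. f p \<partial>N x \<partial>\<mu>)"
    using nn_integral_bind[OF f N] by simp
  moreover have "(\<integral>\<^sup>+p. f p \<partial>N x) = (\<integral>\<^sup>+y. f (x, y) \<partial>\<kappa> x)" for x
    unfolding N_def using f Pair by (simp add: nn_integral_distr)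
  ultimately show ?thesis
    by simp
qed

lemma disintegration_AE:
  assumes ae: "AE p in \<pi>. P p" and P: "{p. P p} \<in> sets borel"
  shows "AE x in \<mu>. AE y in \<kappa> x. P (x, y)"
proof -
  have N: "{p. \<not> P p} \<in> sets borel"
    using sets.compl_sets[OF P] by (simp add: Compl_eq_Diff_UNIV[symmetric] Collect_neg_eq)
  have "emeasure \<pi> {p. \<not> P p} = 0"
    using ae N by (subst (asm) AE_iff_measurable) (auto simp: sets_pi sets_eq_imp_space_eq[OF sets_pi])
  have ind: "indicator {p. \<not> P p} \<in> borel_measurable (borel :: ('a \<times> 'a) measure)"
    using N by simp
  have "(\<integral>\<^sup>+x. \<integral>\<^sup>+y. indicator {p. \<not> P p} (x, y) \<partial>\<kappa> x \<partial>\<mu>) = 0"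
    using disintegration_nn_integral[OF ind] N \<open>emeasure \<pi> _ = 0\<close> by (simp add: sets_pi)
  then have "AE x in \<mu>. (\<integral>\<^sup>+y. indicator {p. \<not> P p} (x, y) \<partial>\<kappa> x) = 0"
    using disintegration_nn_integral_section_measurable[OF ind] by (simp add: nn_integral_0_iff_AE)
  then show ?thesis
  proof eventually_elim
    case (elim x)
    have "(\<lambda>y. indicator {p. \<not> P p} (x, y) :: ennreal) \<in> borel_measurable (\<kappa> x)"
      using measurable_compose[OF _ ind, of "Pair x" borel] disintegration_section(2)[of x]
      by (simp cong: measurable_cong_sets)
    with elim have "AE y in \<kappa> x. indicator {p. \<not> P p} (x, y) = (0 :: ennreal)"
      by (simp add: nn_integral_0_iff_AE)
    then show ?case
      by (auto simp: indicator_def elim: eventually_mono split: if_splits)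
  qed
qed

lemma disintegration_integral:
  fixes f :: "'a \<times> 'a \<Rightarrow> real"
  assumes f: "integrable \<pi> f"
  shows "AE x in \<mu>. integrable (\<kappa> x) (\<lambda>y. f (x, y))"
    and "integrable \<mu> (\<lambda>x. \<integral>y. f (x, y) \<partial>\<kappa> x)"
    and "(\<integral>x. \<integral>y. f (x, y) \<partial>\<kappa> x \<partial>\<mu>) = (\<integral>p. f p \<partial>\<pi>)"
proof -
  have fm: "f \<in> borel_measurable borel"
    using borel_measurable_integrable[OF f] sets_pi by (simp cong: measurable_cong_sets)
  have fsec: "(\<lambda>y. f (x, y)) \<in> borel_measurable (\<kappa> x)" for x
    using measurable_compose[OF _ fm, of "Pair x" borel] disintegration_section(2)[of x]
    by (simp cong: measurable_cong_sets)
  have part: "(AE x in \<mu>. (\<integral>\<^sup>+y. ennreal (g (x, y)) \<partial>\<kappa> x) < \<infinity>) \<and>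
      integrable \<mu> (\<lambda>x. enn2real (\<integral>\<^sup>+y. ennreal (g (x, y)) \<partial>\<kappa> x)) \<and>
      (\<integral>x. enn2real (\<integral>\<^sup>+y. ennreal (g (x, y)) \<partial>\<kappa> x) \<partial>\<mu>) = enn2real (\<integral>\<^sup>+p. ennreal (g p) \<partial>\<pi>)"
    if g: "g \<in> borel_measurable borel" and fin: "(\<integral>\<^sup>+p. ennreal (g p) \<partial>\<pi>) < \<infinity>" for g :: "'a \<times> 'a \<Rightarrow> real"
  proof -
    define G where "G x = (\<integral>\<^sup>+y. ennreal (g (x, y)) \<partial>\<kappa> x)" for x
    have G[measurable]: "G \<in> borel_measurable \<mu>"
      unfolding G_def using g by (intro disintegration_nn_integral_section_measurable[where f = "\<lambda>p. ennreal (g p)"]) simp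
    have int: "(\<integral>\<^sup>+x. G x \<partial>\<mu>) = (\<integral>\<^sup>+p. ennreal (g p) \<partial>\<pi>)"
      unfolding G_def using g by (intro disintegration_nn_integral[where f = "\<lambda>p. ennreal (g p)", symmetric]) simp
    then have ae: "AE x in \<mu>. G x < \<infinity>"
      using fin nn_integral_PInf_AE[OF G] by (auto simp: less_top)
    have eq: "(\<integral>\<^sup>+x. ennreal (enn2real (G x)) \<partial>\<mu>) = (\<integral>\<^sup>+x. G x \<partial>\<mu>)"
      using ae by (intro nn_integral_cong_AE) auto
    have "integrable \<mu> (\<lambda>x. enn2real (G x))"
      using fin int eq by (intro integrableI_nonneg) auto
    moreover have "(\<integral>x. enn2real (G x) \<partial>\<mu>) = enn2real (\<integral>\<^sup>+p. ennreal (g p) \<partial>\<pi>)"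
      using int eq by (subst integral_eq_nn_integral) auto
    ultimately show ?thesis
      using ae by (simp add: G_def)
  qed
  have fin: "(\<integral>\<^sup>+p. ennreal (f p) \<partial>\<pi>) < \<infinity>" "(\<integral>\<^sup>+p. ennreal (- f p) \<partial>\<pi>) < \<infinity>"
    using f by (auto simp: real_integrable_def less_top)
  note pos = part[OF fm fin(1)]
  have fm': "(\<lambda>p. - f p) \<in> borel_measurable borel"
    using fm by simp
  note neg = part[OF fm' fin(2)]
  show int: "AE x in \<mu>. integrable (\<kappa> x) (\<lambda>y. f (x, y))"
    using conjunct1[OF pos] conjunct1[OF neg]
    by eventually_elim (use fsec in \<open>auto simp: real_integrable_def\<close>)
  have eq: "AE x in \<mu>. enn2real (\<integral>\<^sup>+y. ennreal (f (x, y)) \<partial>\<kappa> x) - enn2real (\<integral>\<^sup>+y. ennreal (- f (x, y)) \<partial>\<kappa> x)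
      = (\<integral>y. f (x, y) \<partial>\<kappa> x)"
    using int by eventually_elim (simp add: real_lebesgue_integral_def)
  have meas: "(\<lambda>x. \<integral>y. f (x, y) \<partial>\<kappa> x) \<in> borel_measurable \<mu>"
  proof -
    have "(\<lambda>x. \<integral>p. f p \<partial>distr (\<kappa> x) borel (Pair x)) \<in> borel_measurable \<mu>"
      using fibre_kernel integral_measurable_subprob_algebra[OF fm] by (rule measurable_compose)
    moreover have "(\<integral>p. f p \<partial>distr (\<kappa> x) borel (Pair x)) = (\<integral>y. f (x, y) \<partial>\<kappa> x)" for x
      using fm disintegration_section(2)[of x]
      by (intro integral_distr) (simp_all cong: measurable_cong_sets)
    ultimately show ?thesis
      by simp
  qed
  show "integrable \<mu> (\<lambda>x. \<integral>y. f (x, y) \<partial>\<kappa> x)"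
    using pos neg by (intro integrable_cong_AE_imp[OF _ meas eq] Bochner_Integration.integrable_diff) auto
  have "(\<integral>x. \<integral>y. f (x, y) \<partial>\<kappa> x \<partial>\<mu>)
      = (\<integral>x. enn2real (\<integral>\<^sup>+y. ennreal (f (x, y)) \<partial>\<kappa> x) - enn2real (\<integral>\<^sup>+y. ennreal (- f (x, y)) \<partial>\<kappa> x) \<partial>\<mu>)"
    using pos neg meas eq by (intro integral_cong_AE) (auto intro: borel_measurable_integrable)
  also have "\<dots> = (\<integral>p. f p \<partial>\<pi>)"
    using pos neg f by (simp add: real_lebesgue_integral_def)
  finally show "(\<integral>x. \<integral>y. f (x, y) \<partial>\<kappa> x \<partial>\<mu>) = (\<integral>p. f p \<partial>\<pi>)" .
qed

end

section \<open>Supports and barycentres\<close>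

lemma closed_supp: "closed (supp M)"
proof -
  have "- supp M = \<Union>{U. open U \<and> emeasure M U = 0}"
    by (auto simp: supp_def)
  then show ?thesis
    by (auto simp: closed_def)
qed

text \<open>
  The complement of the support is a union of null sets from a countable base.
\<close>

lemma AE_in_supp:
  fixes M :: "'a::second_countable_topology measure"
  assumes "sets M = sets borel"
  shows "AE y in M. y \<in> supp M"
proof -
  obtain \<B> :: "'a set set" where B: "countable \<B>" "topological_basis \<B>"
    using ex_countable_basis by blast
  have "- supp M \<subseteq> \<Union>{b \<in> \<B>. emeasure M b = 0}"
  proof
    fix y assume "y \<in> - supp M"
    then obtain U where U: "open U" "y \<in> U" "emeasure M U = 0"
      by (auto simp: supp_def)
    obtain b where b: "b \<in> \<B>" "y \<in> b" "b \<subseteq> U"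
      using topological_basisE[OF B(2) U(1,2)] by blast
    have "emeasure M b \<le> emeasure M U"
      using b U assms by (intro emeasure_mono) auto
    with b U show "y \<in> \<Union>{b \<in> \<B>. emeasure M b = 0}"
      by auto
  qed
  moreover have "\<Union>{b \<in> \<B>. emeasure M b = 0} \<in> null_sets M"
  proof -
    have "(\<Union>b\<in>{b \<in> \<B>. emeasure M b = 0}. b) \<in> null_sets M"
      using B assms topological_basis_open[OF B(2)]
      by (intro null_sets_UN') (auto simp: null_sets_def intro: countable_subset)
    then show ?thesis
      by simp
  qed
  ultimately show ?thesis
    by (intro AE_I') auto
qed

lemma supp_subset_closed:
  assumes "sets M = sets borel" "closed C" and ae: "AE y in M. y \<in> C"
  shows "supp M \<subseteq> C"
proof
  fix y assume y: "y \<in> supp M"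
  show "y \<in> C"
  proof (rule ccontr)
    assume "y \<notin> C"
    then have "emeasure M (- C) > 0"
      using y \<open>closed C\<close> by (auto simp: supp_def)
    moreover have "emeasure M (- C) = 0"
      using ae assms
      by (subst (asm) AE_iff_measurable[where N = "- C"]) (auto simp: sets_eq_imp_space_eq[OF assms(1)])
    ultimately show False
      by simp
  qed
qed

lemma closure_eq_supp:
  fixes M :: "'a::second_countable_topology measure"
  assumes "sets M = sets borel" "A \<subseteq> supp M" "AE y in M. y \<in> A"
  shows "closure A = supp M"
proof
  show "closure A \<subseteq> supp M"
    using assms closed_supp by (intro closure_minimal)
  have "AE y in M. y \<in> closure A"
    using assms(3) by eventually_elim (use closure_subset in auto)
  then show "supp M \<subseteq> closure A"
    using assms by (intro supp_subset_closed) auto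
qed

text \<open>
  Otherwise a hyperplane through or beside \<open>x\<close> has all of \<open>A\<close> on one side, and some point of
  the hull strictly. The barycentre condition puts almost all mass on the hyperplane through \<open>x\<close>, which is
  closed and so contains the whole support. It is here that \<open>A\<close> has to lie in the support: a null
  part of \<open>A\<close> off the hyperplane would move \<open>x\<close> to the relative boundary of the hull.
\<close>

lemma barycenter_in_IC:
  fixes M :: "'a::euclidean_space measure"
  assumes "prob_space M" and sets: "sets M = sets borel" and bary: "has_barycenter M x"
    and A: "A \<subseteq> supp M" "AE y in M. y \<in> A"
  shows "x \<in> IC A"
proof (rule ccontr)
  interpret prob_space M by fact
  assume "x \<notin> IC A"
  then have x: "x \<notin> rel_interior (convex hull A)"
    by (simp add: IC_def)
  have "A \<noteq> {}"
    using A(2) by (auto simp: AE_False)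
  obtain a z where a: "\<And>y. y \<in> A \<Longrightarrow> a \<bullet> x \<le> a \<bullet> y" and z: "z \<in> convex hull A" "a \<bullet> x < a \<bullet> z"
  proof (cases "x \<in> closure (convex hull A)")
    case True
    obtain a where a: "\<And>y. y \<in> closure (convex hull A) \<Longrightarrow> a \<bullet> x \<le> a \<bullet> y"
        "\<And>y. y \<in> rel_interior (convex hull A) \<Longrightarrow> a \<bullet> x < a \<bullet> y"
      using supporting_hyperplane_relative_frontier[OF convex_convex_hull True x] by metis
    have "rel_interior (convex hull A) \<noteq> {}"
      using \<open>A \<noteq> {}\<close> by (simp add: rel_interior_eq_empty)
    then obtain z where "z \<in> rel_interior (convex hull A)"
      by blast
    then show ?thesis
      using that[of a z] a rel_interior_subset closure_subset hull_subset[of A convex] by blast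
  next
    case False
    then obtain a b where ab: "a \<bullet> x < b" "\<And>y. y \<in> closure (convex hull A) \<Longrightarrow> b < a \<bullet> y"
      using separating_hyperplane_closed_point[of "closure (convex hull A)" x] by (auto simp: convex_closure)
    have hull: "y \<in> closure (convex hull A)" "y \<in> convex hull A" if "y \<in> A" for y
      using that by (auto intro: hull_inc subsetD[OF closure_subset])
    obtain z where "z \<in> A"
      using \<open>A \<noteq> {}\<close> by blast
    have "a \<bullet> x < a \<bullet> y" if "y \<in> A" for y
      using ab hull(1)[OF that] by (meson less_trans)
    then show ?thesis
      using that[of a z] \<open>z \<in> A\<close> hull by (meson less_imp_le)
  qed
  have int: "integrable M (\<lambda>y. y)" "(\<integral>y. y \<partial>M) = x"
    using bary by (auto simp: has_barycenter_def)
  have nonneg: "AE y in M. 0 \<le> a \<bullet> y - a \<bullet> x"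
    using A(2) by eventually_elim (use a in auto)
  have "(\<integral>y. a \<bullet> y - a \<bullet> x \<partial>M) = 0"
    using int by (simp add: prob_space)
  then have "AE y in M. a \<bullet> y - a \<bullet> x = 0"
    using int nonneg by (subst (asm) integral_nonneg_eq_0_iff_AE) auto
  then have "supp M \<subseteq> {y. a \<bullet> y = a \<bullet> x}"
    using sets by (intro supp_subset_closed) (auto simp: closed_hyperplane)
  then have "convex hull A \<subseteq> {y. a \<bullet> y = a \<bullet> x}"
    using A(1) by (intro hull_minimal convex_hyperplane) auto
  then show False
    using z by auto
qed

section \<open>Optimal plans are carried by contact layers\<close>

text \<open>
  The barycentre property is given for some disintegration only. The coordinates of the
  barycentres of any two disintegrations have the same integrals over every Borel set of base
  points, namely the integrals of the coordinates of \<open>snd\<close> over its preimage, so they agree almost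
  everywhere.
\<close>

lemma AE_has_barycenter_disintegration:
  fixes \<mu> :: "'a::euclidean_space measure"
  assumes sets: "sets \<mu> = sets borel" "sets \<pi> = sets borel"
    and first_moment: "integrable \<pi> (\<lambda>p. norm (snd p))"
    and \<kappa>: "disintegration \<mu> \<pi> \<kappa>" and \<kappa>': "disintegration \<mu> \<pi> \<kappa>'"
    and bary: "AE x in \<mu>. has_barycenter (\<kappa>' x) x"
  shows "AE x in \<mu>. has_barycenter (\<kappa> x) x"
proof -
  note dis = disintegration_integral[OF sets \<kappa>] and dis' = disintegration_integral[OF sets \<kappa>']
  have space: "space \<mu> = UNIV"
    using sets_eq_imp_space_eq[OF sets(1)] by simp
  have fst_m: "fst \<in> measurable \<pi> borel" and snd_m: "snd \<in> borel_measurable \<pi>"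
    using sets(2) by (simp_all add: borel_prod[symmetric] cong: measurable_cong_sets)
  have coord: "integrable \<pi> (\<lambda>p. snd p \<bullet> b)" if "b \<in> Basis" for b
    using first_moment snd_m that
    by (intro Bochner_Integration.integrable_bound[OF first_moment]) (auto simp: Basis_le_norm)
  have "AE x in \<mu>. (\<integral>y. y \<bullet> b \<partial>\<kappa> x) = (\<integral>y. y \<bullet> b \<partial>\<kappa>' x)" if b: "b \<in> Basis" for b
  proof (rule density_unique_real)
    show "integrable \<mu> (\<lambda>x. \<integral>y. y \<bullet> b \<partial>\<kappa> x)" "integrable \<mu> (\<lambda>x. \<integral>y. y \<bullet> b \<partial>\<kappa>' x)"
      using dis(2)[OF coord[OF b]] dis'(2)[OF coord[OF b]] by simp_all
    fix A assume A: "A \<in> sets \<mu>"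
    have "fst -` A \<inter> space \<pi> \<in> sets \<pi>"
      using A sets by (intro measurable_sets[OF fst_m]) simp
    then have "integrable \<pi> (\<lambda>p. indicator (fst -` A \<inter> space \<pi>) p *\<^sub>R (snd p \<bullet> b))"
      using coord[OF b] by (rule integrable_mult_indicator)
    also have "(\<lambda>p. indicator (fst -` A \<inter> space \<pi>) p *\<^sub>R (snd p \<bullet> b)) = (\<lambda>p. indicator A (fst p) * (snd p \<bullet> b))"
      using sets_eq_imp_space_eq[OF sets(2)] by (auto simp: indicator_def fun_eq_iff)
    finally have int: "integrable \<pi> (\<lambda>p. indicator A (fst p) * (snd p \<bullet> b))" .
    show "set_lebesgue_integral \<mu> A (\<lambda>x. \<integral>y. y \<bullet> b \<partial>\<kappa> x) = set_lebesgue_integral \<mu> A (\<lambda>x. \<integral>y. y \<bullet> b \<partial>\<kappa>' x)"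
      using dis(3)[OF int] dis'(3)[OF int] by (simp add: set_lebesgue_integral_def)
  qed
  then have eq: "AE x in \<mu>. \<forall>b\<in>Basis. (\<integral>y. y \<bullet> b \<partial>\<kappa> x) = (\<integral>y. y \<bullet> b \<partial>\<kappa>' x)"
    by (intro AE_finite_allI) auto
  have id: "AE x in \<mu>. integrable (\<kappa> x) (\<lambda>y. y)"
    using dis(1)[OF first_moment]
  proof eventually_elim
    case (elim x)
    have "(\<lambda>y. y) \<in> borel_measurable (\<kappa> x)"
      using disintegration_section(2)[OF sets \<kappa>, of x] by (simp cong: measurable_cong_sets)
    with elim show ?case
      by (simp add: integrable_norm_iff)
  qed
  show ?thesis
    using eq id bary
  proof eventually_elim
    case (elim x)
    have "(\<integral>y. y \<partial>\<kappa> x) = x"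
    proof (rule euclidean_eqI)
      fix b :: 'a assume b: "b \<in> Basis"
      have "(\<integral>y. y \<partial>\<kappa> x) \<bullet> b = (\<integral>y. y \<bullet> b \<partial>\<kappa> x)"
        using elim(2) by simp
      also have "\<dots> = (\<integral>y. y \<bullet> b \<partial>\<kappa>' x)"
        using elim(1) b by simp
      also have "\<dots> = x \<bullet> b"
        using elim(3) by (simp add: has_barycenter_def)
      finally show "(\<integral>y. y \<partial>\<kappa> x) \<bullet> b = x \<bullet> b" .
    qed
    with elim(2) show ?case
      by (simp add: has_barycenter_def)
  qed
qed

text \<open>
  The part of \<open>\<pi>\<close> on the diagonal has equal marginals, and these are dominated by both \<open>\<mu>\<close> and \<open>\<nu>\<close>.
\<close>

lemma AE_off_diagonal_of_inf_eq_null: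
  fixes \<mu> \<nu> :: "'a::euclidean_space measure"
  assumes sets: "sets \<mu> = sets borel" "sets \<nu> = sets borel" "sets \<pi> = sets borel"
    and marginals: "distr \<pi> borel fst = \<mu>" "distr \<pi> borel snd = \<nu>"
    and inf: "inf \<mu> \<nu> = null_measure borel"
  shows "AE p in \<pi>. fst p \<noteq> snd p"
proof -
  define D where "D = {p :: 'a \<times> 'a. fst p = snd p}"
  have space: "space \<pi> = UNIV"
    using sets_eq_imp_space_eq[OF sets(3)] by simp
  have D: "D \<in> sets borel"
    unfolding D_def by (intro borel_closed closed_Collect_eq continuous_intros)
  have fst_m: "fst \<in> measurable \<pi> borel" and snd_m: "snd \<in> measurable \<pi> borel"
    using sets(3) by (simp_all add: borel_prod[symmetric] cong: measurable_cong_sets)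
  define m where "m = distr (density \<pi> (indicator D)) borel fst"
  have m: "emeasure m A = emeasure \<pi> (D \<inter> (fst -` A))" if "A \<in> sets borel" for A
  proof -
    have "(fst :: 'a \<times> 'a \<Rightarrow> 'a) -` A \<in> sets borel"
      using measurable_sets[OF fst_m that] space sets(3) by simp
    then show ?thesis
      unfolding m_def using that D sets(3) space fst_m
      by (subst emeasure_distr)
         (simp_all add: emeasure_density nn_integral_indicator flip: indicator_inter_arith cong: measurable_cong_sets)
  qed
  have le: "emeasure m A \<le> emeasure \<mu> A" "emeasure m A \<le> emeasure \<nu> A" if A: "A \<in> sets borel" for A
  proof -
    have pre: "fst -` A \<in> sets \<pi>" "snd -` A \<in> sets \<pi>"
      using measurable_sets[OF fst_m A] measurable_sets[OF snd_m A] space by simp_all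
    have "emeasure m A \<le> emeasure \<pi> (fst -` A)" "emeasure m A \<le> emeasure \<pi> (snd -` A)"
      unfolding m[OF A] using pre by (auto intro!: emeasure_mono simp: D_def)
    moreover have "emeasure \<mu> A = emeasure \<pi> (fst -` A)" "emeasure \<nu> A = emeasure \<pi> (snd -` A)"
      using emeasure_distr[OF fst_m A] emeasure_distr[OF snd_m A] space marginals by simp_all
    ultimately show "emeasure m A \<le> emeasure \<mu> A" "emeasure m A \<le> emeasure \<nu> A"
      by simp_all
  qed
  have sets_m: "sets m = sets borel"
    by (simp add: m_def)
  have "emeasure m UNIV \<le> emeasure (inf \<mu> \<nu>) UNIV"
  proof (rule inf_measure_greatest(4)[OF sets(1,2) sets_m])
    show "emeasure m A \<le> emeasure \<mu> A" "emeasure m A \<le> emeasure \<nu> A" for A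
      using le[of A] emeasure_notin_sets[of A m] sets_m by (cases "A \<in> sets borel"; simp)+
  qed
  then have "emeasure \<pi> D = 0"
    using m[of UNIV] inf by simp
  then show ?thesis
    using D sets(3) by (intro AE_I'[of D]) (auto simp: D_def null_sets_def)
qed

text \<open>
  The gap \<open>h\<close> without its \<open>\<gamma>\<close> term is integrable, with integral zero by equality of the primal and
  dual values. The term \<open>\<gamma> x \<bullet> (y - x)\<close>, whose coefficient \<open>\<gamma>\<close> carries no integrability, is added only
  fibre by fibre, where it integrates to zero by the barycentre property. The resulting signed gap
  \<open>g\<close> is nonnegative, so the fibre integrals of \<open>h\<close> are nonnegative and add up to zero.
\<close>

lemma AE_contact_of_dual_optimal:
  fixes \<mu> \<nu> :: "'a::euclidean_space measure"
  assumes sets: "sets \<mu> = sets borel" "sets \<nu> = sets borel" "sets \<pi> = sets borel"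
    and marginals: "distr \<pi> borel fst = \<mu>" "distr \<pi> borel snd = \<nu>"
    and first_moments: "integrable \<mu> norm" "integrable \<nu> norm"
    and \<kappa>: "disintegration \<mu> \<pi> \<kappa>" and bary: "AE x in \<mu>. has_barycenter (\<kappa> x) x"
    and ineq: "\<And>x y. 0 \<le> s * (\<beta> y - \<alpha> x - \<gamma> x \<bullet> (y - x) - norm (x - y))"
    and s: "s = 1 \<or> s = - 1"
    and int: "integrable \<mu> \<alpha>" "integrable \<nu> \<beta>"
    and value_eq: "(\<integral>y. \<beta> y \<partial>\<nu>) - (\<integral>x. \<alpha> x \<partial>\<mu>) = total_cost dist_cost \<pi>"
  shows "AE x in \<mu>. AE y in \<kappa> x. \<beta> y - \<alpha> x - \<gamma> x \<bullet> (y - x) = norm (x - y)"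
proof -
  have fst_m: "fst \<in> measurable \<pi> borel" and snd_m: "snd \<in> measurable \<pi> borel"
    using sets(3) by (simp_all add: borel_prod[symmetric] cong: measurable_cong_sets)
  have pull: "integrable \<pi> (\<lambda>p. f (fst p))" "(\<integral>p. f (fst p) \<partial>\<pi>) = (\<integral>x. f x \<partial>\<mu>)"
    if "integrable \<mu> f" for f :: "'a \<Rightarrow> real"
  proof -
    have f: "f \<in> borel_measurable borel"
      using borel_measurable_integrable[OF that] sets(1) by (simp cong: measurable_cong_sets)
    show "integrable \<pi> (\<lambda>p. f (fst p))" "(\<integral>p. f (fst p) \<partial>\<pi>) = (\<integral>x. f x \<partial>\<mu>)"
      using that integrable_distr_eq[OF fst_m f] integral_distr[OF fst_m f] marginals(1) by simp_all
  qed
  have pull': "integrable \<pi> (\<lambda>p. f (snd p))" "(\<integral>p. f (snd p) \<partial>\<pi>) = (\<integral>x. f x \<partial>\<nu>)"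
    if "integrable \<nu> f" for f :: "'a \<Rightarrow> real"
  proof -
    have f: "f \<in> borel_measurable borel"
      using borel_measurable_integrable[OF that] sets(2) by (simp cong: measurable_cong_sets)
    show "integrable \<pi> (\<lambda>p. f (snd p))" "(\<integral>p. f (snd p) \<partial>\<pi>) = (\<integral>x. f x \<partial>\<nu>)"
      using that integrable_distr_eq[OF snd_m f] integral_distr[OF snd_m f] marginals(2) by simp_all
  qed
  have cost: "integrable \<pi> (\<lambda>p. norm (fst p - snd p))"
  proof (rule Bochner_Integration.integrable_bound)
    show "integrable \<pi> (\<lambda>p. norm (fst p) + norm (snd p))"
      using pull(1)[OF first_moments(1)] pull'(1)[OF first_moments(2)] by simp
    show "(\<lambda>p. norm (fst p - snd p)) \<in> borel_measurable \<pi>"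
      using fst_m snd_m by measurable
    show "AE p in \<pi>. norm (norm (fst p - snd p)) \<le> norm (norm (fst p) + norm (snd p))"
      by (auto intro: norm_triangle_ineq4)
  qed
  define h where "h p = s * (\<beta> (snd p) - \<alpha> (fst p) - norm (fst p - snd p))" for p
  have h: "integrable \<pi> h"
    unfolding h_def using cost pull(1)[OF int(1)] pull'(1)[OF int(2)] by simp
  have "(\<integral>p. h p \<partial>\<pi>) = s * ((\<integral>y. \<beta> y \<partial>\<nu>) - (\<integral>x. \<alpha> x \<partial>\<mu>) - total_cost dist_cost \<pi>)"
    unfolding h_def using cost pull[OF int(1)] pull'[OF int(2)]
    by (simp add: total_cost_def dist_cost_def)
  then have h0: "(\<integral>p. h p \<partial>\<pi>) = 0"
    using value_eq by simp
  note dis = disintegration_integral[OF sets(1,3) \<kappa> h]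
  define g where "g x y = h (x, y) - (s *\<^sub>R \<gamma> x) \<bullet> (y - x)" for x y
  have g_eq: "g x y = s * (\<beta> y - \<alpha> x - \<gamma> x \<bullet> (y - x) - norm (x - y))" for x y
    by (simp add: g_def h_def algebra_simps)
  have g: "AE x in \<mu>. integrable (\<kappa> x) (g x) \<and> (\<integral>y. g x y \<partial>\<kappa> x) = (\<integral>y. h (x, y) \<partial>\<kappa> x)"
    using dis(1) bary
  proof eventually_elim
    case (elim x)
    interpret K: prob_space "\<kappa> x"
      by (rule disintegration_section[OF sets(1,3) \<kappa>])
    have b: "integrable (\<kappa> x) (\<lambda>y. y)" "(\<integral>y. y \<partial>\<kappa> x) = x"
      using elim(2) by (auto simp: has_barycenter_def)
    then have lin: "integrable (\<kappa> x) (\<lambda>y. y - x)" "(\<integral>y. y - x \<partial>\<kappa> x) = 0"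
      by (simp_all add: K.prob_space)
    then have "integrable (\<kappa> x) (\<lambda>y. (s *\<^sub>R \<gamma> x) \<bullet> (y - x))" "(\<integral>y. (s *\<^sub>R \<gamma> x) \<bullet> (y - x) \<partial>\<kappa> x) = 0"
      using integrable_inner_right[of "s *\<^sub>R \<gamma> x" "\<kappa> x" "\<lambda>y. y - x"]
        integral_inner_right[of "s *\<^sub>R \<gamma> x" "\<kappa> x" "\<lambda>y. y - x"] by (simp_all del: integral_inner_right)
    then show ?case
      unfolding g_def using elim(1) by simp
  qed
  have "AE x in \<mu>. 0 \<le> (\<integral>y. h (x, y) \<partial>\<kappa> x)"
    using g
  proof eventually_elim
    case (elim x)
    have "0 \<le> (\<integral>y. g x y \<partial>\<kappa> x)"
      using ineq g_eq by (intro integral_nonneg_AE) simp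
    with elim show ?case
      by simp
  qed
  then have "AE x in \<mu>. (\<integral>y. h (x, y) \<partial>\<kappa> x) = 0"
    using dis(2,3) h0 integral_nonneg_eq_0_iff_AE[OF dis(2)] by simp
  with g show ?thesis
  proof eventually_elim
    case (elim x)
    then have "integrable (\<kappa> x) (g x)" "(\<integral>y. g x y \<partial>\<kappa> x) = 0"
      by simp_all
    moreover have "AE y in \<kappa> x. 0 \<le> g x y"
      using ineq by (simp add: g_eq)
    ultimately have "AE y in \<kappa> x. g x y = 0"
      using integral_nonneg_eq_0_iff_AE by blast
    then show ?case
      by eventually_elim (use s g_eq in auto)
  qed
qed

lemma AE_absolutely_continuous_negligible:
  fixes \<mu> :: "'a::euclidean_space measure"
  assumes "sets \<mu> = sets borel" "absolutely_continuous lborel \<mu>" "negligible N"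
  shows "AE x in \<mu>. x \<notin> N"
proof -
  have "AE x in lebesgue. x \<notin> N"
    using assms(3) by (intro AE_not_in) (simp add: negligible_iff_null_sets)
  then have "AE x in lborel. x \<notin> N"
    by (simp add: AE_completion_iff)
  then show ?thesis
    using assms by (intro absolutely_continuous_AE[of \<mu> lborel]) auto
qed

text \<open>
  The layer consists of the contact points in the supports, over those \<open>x\<close> for which contact and
  barycentre condition hold. Restricting to the supports makes \<open>barycenter_in_IC\<close> applicable, and the
  sections, being of full measure, are dense in the supports.
\<close>

lemma AE_extreme_of_contact:
  fixes \<mu> :: "'a::euclidean_space measure"
  assumes sets: "sets \<mu> = sets borel" and ac: "absolutely_continuous lborel \<mu>"
    and \<kappa>: "\<And>x. prob_space (\<kappa> x)" "\<And>x. sets (\<kappa> x) = sets borel"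
    and bary: "AE x in \<mu>. has_barycenter (\<kappa> x) x"
    and ineq: "\<And>x y. 0 \<le> s * (\<beta> y - \<alpha> x - \<gamma> x \<bullet> (y - x) - norm (x - y))"
    and s: "s = 1 \<or> s = - 1"
    and contact: "AE x in \<mu>. AE y in \<kappa> x. \<beta> y - \<alpha> x - \<gamma> x \<bullet> (y - x) = norm (x - y)"
    and off_diagonal: "s = - 1 \<Longrightarrow> AE x in \<mu>. AE y in \<kappa> x. y \<noteq> x"
  shows "AE x in \<mu>. supp (\<kappa> x) = Ext (convex hull (supp (\<kappa> x)))"
proof -
  define R where "R x y \<longleftrightarrow> \<beta> y - \<alpha> x - \<gamma> x \<bullet> (y - x) = norm (x - y) \<and> (s = - 1 \<longrightarrow> y \<noteq> x)" for x y
  define G where "G = {x. (AE y in \<kappa> x. R x y) \<and> has_barycenter (\<kappa> x) x}"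
  define \<Gamma> where "\<Gamma> = {(x, y). x \<in> G \<and> y \<in> supp (\<kappa> x) \<and> R x y}"
  have off: "AE x in \<mu>. AE y in \<kappa> x. s = - 1 \<longrightarrow> y \<noteq> x"
    using off_diagonal by (cases "s = - 1") auto
  have good: "AE x in \<mu>. x \<in> G"
    using contact off bary
  proof eventually_elim
    case (elim x)
    have "AE y in \<kappa> x. R x y"
      using elim(1,2) by eventually_elim (simp add: R_def)
    with elim(3) show ?case
      by (simp add: G_def)
  qed
  have sections: "\<Gamma> `` {x} \<subseteq> supp (\<kappa> x)" "AE y in \<kappa> x. y \<in> \<Gamma> `` {x}" if "x \<in> G" for x
  proof -
    show "\<Gamma> `` {x} \<subseteq> supp (\<kappa> x)"
      by (auto simp: \<Gamma>_def)
    have "AE y in \<kappa> x. R x y"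
      using that by (simp add: G_def)
    then show "AE y in \<kappa> x. y \<in> \<Gamma> `` {x}"
      using AE_in_supp[OF \<kappa>(2)[of x]] by eventually_elim (use that in \<open>simp add: \<Gamma>_def\<close>)
  qed
  interpret signed_contact_layer \<Gamma> \<alpha> \<gamma> \<beta> s
  proof
    show "x \<in> IC (\<Gamma> `` {x})" if "x \<in> Domain \<Gamma>" for x
    proof -
      have "x \<in> G"
        using that by (auto simp: \<Gamma>_def)
      then have "has_barycenter (\<kappa> x) x"
        by (simp add: G_def)
      then show ?thesis
        by (rule barycenter_in_IC[OF \<kappa> _ sections[OF \<open>x \<in> G\<close>]])
    qed
  qed (use s ineq in \<open>auto simp: \<Gamma>_def R_def\<close>)
  have "negligible {x \<in> Domain \<Gamma>. closure (\<Gamma> `` {x}) \<noteq> Ext (convex hull (closure (\<Gamma> `` {x})))}"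
    by (rule negligible_not_extreme) (auto simp: \<Gamma>_def R_def)
  from AE_absolutely_continuous_negligible[OF sets ac this] good show ?thesis
  proof eventually_elim
    case (elim x)
    interpret K: prob_space "\<kappa> x"
      by (rule \<kappa>)
    have "\<Gamma> `` {x} \<noteq> {}"
    proof
      assume empty: "\<Gamma> `` {x} = {}"
      have "AE y in \<kappa> x. False"
        using sections(2)[OF elim(2)] unfolding empty by simp
      then show False
        by (simp add: K.AE_False)
    qed
    moreover have "closure (\<Gamma> `` {x}) = supp (\<kappa> x)"
      using sections[OF elim(2)] \<kappa> by (intro closure_eq_supp)
    ultimately show ?case
      using elim(1) by auto
  qed
qed

lemma AE_extreme_of_optimal:
  fixes \<mu> \<nu> :: "'a::euclidean_space measure"
  assumes sets: "sets \<mu> = sets borel" "sets \<nu> = sets borel"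
    and order: "convex_order \<mu> \<nu>" and ac: "absolutely_continuous lborel \<mu>"
    and \<pi>: "\<pi> \<in> MT \<mu> \<nu>" and \<kappa>: "disintegration \<mu> \<pi> \<kappa>"
    and s: "s = 1 \<or> s = - 1"
    and ineq: "\<And>x y. 0 \<le> s * (\<beta> y - \<alpha> x - \<gamma> x \<bullet> (y - x) - norm (x - y))"
    and int: "integrable \<mu> \<alpha>" "integrable \<nu> \<beta>"
    and value_eq: "(\<integral>y. \<beta> y \<partial>\<nu>) - (\<integral>x. \<alpha> x \<partial>\<mu>) = total_cost dist_cost \<pi>"
    and singular: "s = - 1 \<Longrightarrow> inf \<mu> \<nu> = null_measure borel"
  shows "AE x in \<mu>. supp (\<kappa> x) = Ext (convex hull (supp (\<kappa> x)))"
proof -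
  obtain \<kappa>' where sets_pi: "sets \<pi> = sets borel"
    and marginals: "distr \<pi> borel fst = \<mu>" "distr \<pi> borel snd = \<nu>"
    and \<kappa>': "disintegration \<mu> \<pi> \<kappa>'" "AE x in \<mu>. has_barycenter (\<kappa>' x) x"
    using \<pi> by (auto simp: MT_def)
  have moments: "integrable \<mu> norm" "integrable \<nu> norm"
    using order by (simp_all add: convex_order_def)
  have snd_m: "snd \<in> measurable \<pi> borel"
    using sets_pi by (simp add: borel_prod[symmetric] cong: measurable_cong_sets)
  have "(norm :: 'a \<Rightarrow> real) \<in> borel_measurable borel"
    by simp
  then have "integrable \<pi> (\<lambda>p. norm (snd p))"
    using moments(2) marginals(2) integrable_distr_eq[OF snd_m] by metis
  then have bary: "AE x in \<mu>. has_barycenter (\<kappa> x) x"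
    by (rule AE_has_barycenter_disintegration[OF sets(1) sets_pi _ \<kappa> \<kappa>'])
  have contact: "AE x in \<mu>. AE y in \<kappa> x. \<beta> y - \<alpha> x - \<gamma> x \<bullet> (y - x) = norm (x - y)"
    by (rule AE_contact_of_dual_optimal[OF sets sets_pi marginals moments \<kappa> bary ineq s int value_eq])
  show ?thesis
  proof (rule AE_extreme_of_contact[OF sets(1) ac _ _ bary ineq s contact])
    show "prob_space (\<kappa> x)" "sets (\<kappa> x) = sets borel" for x
      by (rule disintegration_section[OF sets(1) sets_pi \<kappa>])+
    show "AE x in \<mu>. AE y in \<kappa> x. y \<noteq> x" if "s = - 1"
    proof -
      have "AE x in \<mu>. AE y in \<kappa> x. fst (x, y) \<noteq> snd (x, y)"
      proof (rule disintegration_AE[OF sets(1) sets_pi \<kappa>])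
        show "AE p in \<pi>. fst p \<noteq> snd p"
          by (rule AE_off_diagonal_of_inf_eq_null[OF sets sets_pi marginals singular[OF that]])
        show "{p :: 'a \<times> 'a. fst p \<noteq> snd p} \<in> sets borel"
          by (intro borel_open open_Collect_neq continuous_intros)
      qed
      then show ?thesis
        by (simp add: eq_commute)
    qed
  qed
qed

section \<open>The structure theorem\<close>

text \<open>
  Changing the signs of the cost and of all three functions exchanges \<open>E_m\<close> and \<open>E_M\<close>, so that
  only the cost \<open>dist_cost\<close> has to be considered.
\<close>

lemma maximization_case_imp_contact_layer_M:
  assumes "maximization_case c \<Gamma>"
  shows "contact_layer_M dist_cost \<Gamma>"
proof -
  have "contact_layer_M dist_cost \<Gamma>" if layer: "contact_layer_m neg_dist_cost \<Gamma>"
  proof -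
    obtain \<alpha> \<gamma> \<beta> where "\<Gamma> \<noteq> {}" and
        t: "(\<alpha>, \<gamma>, \<beta>) \<in> E_m neg_dist_cost (Domain \<Gamma>) (Range \<Gamma>)" "contact_on neg_dist_cost \<Gamma> (\<alpha>, \<gamma>, \<beta>)"
      using layer by (auto simp: contact_layer_m_def)
    have "dist_cost x y \<le> - \<beta> y - - \<alpha> x - - \<gamma> x \<bullet> (y - x)" if "x \<in> Domain \<Gamma>" "y \<in> Range \<Gamma>" for x y
    proof -
      have "\<beta> y - \<alpha> x - \<gamma> x \<bullet> (y - x) \<le> neg_dist_cost x y"
        using t(1) that unfolding E_m_def by blast
      then show ?thesis
        by (simp add: dist_cost_def neg_dist_cost_def)
    qed
    then have "(\<lambda>x. - \<alpha> x, \<lambda>x. - \<gamma> x, \<lambda>y. - \<beta> y) \<in> E_M dist_cost (Domain \<Gamma>) (Range \<Gamma>)"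
      using t(1) by (simp add: E_m_def E_M_def measurable_triples_def)
    moreover have "contact_on dist_cost \<Gamma> (\<lambda>x. - \<alpha> x, \<lambda>x. - \<gamma> x, \<lambda>y. - \<beta> y)"
      using t(2) by (fastforce simp: contact_on_def dist_cost_def neg_dist_cost_def)
    ultimately show ?thesis
      using \<open>\<Gamma> \<noteq> {}\<close> unfolding contact_layer_M_def by blast
  qed
  then show ?thesis
    using assms by (auto simp: maximization_case_def)
qed

lemma minimization_case_imp_contact_layer_m:
  assumes "minimization_case c \<Gamma>"
  shows "contact_layer_m dist_cost \<Gamma>"
proof -
  have "contact_layer_m dist_cost \<Gamma>" if layer: "contact_layer_M neg_dist_cost \<Gamma>"
  proof -
    obtain \<alpha> \<gamma> \<beta> where "\<Gamma> \<noteq> {}" and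
        t: "(\<alpha>, \<gamma>, \<beta>) \<in> E_M neg_dist_cost (Domain \<Gamma>) (Range \<Gamma>)" "contact_on neg_dist_cost \<Gamma> (\<alpha>, \<gamma>, \<beta>)"
      using layer by (auto simp: contact_layer_M_def)
    have "dist_cost x y \<ge> - \<beta> y - - \<alpha> x - - \<gamma> x \<bullet> (y - x)" if "x \<in> Domain \<Gamma>" "y \<in> Range \<Gamma>" for x y
    proof -
      have "\<beta> y - \<alpha> x - \<gamma> x \<bullet> (y - x) \<ge> neg_dist_cost x y"
        using t(1) that unfolding E_M_def by blast
      then show ?thesis
        by (simp add: dist_cost_def neg_dist_cost_def)
    qed
    then have "(\<lambda>x. - \<alpha> x, \<lambda>x. - \<gamma> x, \<lambda>y. - \<beta> y) \<in> E_m dist_cost (Domain \<Gamma>) (Range \<Gamma>)"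
      using t(1) by (simp add: E_m_def E_M_def measurable_triples_def)
    moreover have "contact_on dist_cost \<Gamma> (\<lambda>x. - \<alpha> x, \<lambda>x. - \<gamma> x, \<lambda>y. - \<beta> y)"
      using t(2) by (fastforce simp: contact_on_def dist_cost_def neg_dist_cost_def)
    ultimately show ?thesis
      using \<open>\<Gamma> \<noteq> {}\<close> unfolding contact_layer_m_def by blast
  qed
  then show ?thesis
    using assms by (auto simp: minimization_case_def)
qed

lemma signed_contact_layer_of_contact_layer:
  assumes "\<Gamma> \<in> S_MT"
  shows "contact_layer_M dist_cost \<Gamma> \<Longrightarrow> \<exists>\<alpha> \<gamma> \<beta>. signed_contact_layer \<Gamma> \<alpha> \<gamma> \<beta> 1"
    and "contact_layer_m dist_cost \<Gamma> \<Longrightarrow> \<exists>\<alpha> \<gamma> \<beta>. signed_contact_layer \<Gamma> \<alpha> \<gamma> \<beta> (- 1)"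
proof -
  have ic: "\<And>x. x \<in> Domain \<Gamma> \<Longrightarrow> x \<in> IC (\<Gamma> `` {x})"
    using assms by (auto simp: S_MT_def)
  show "\<exists>\<alpha> \<gamma> \<beta>. signed_contact_layer \<Gamma> \<alpha> \<gamma> \<beta> 1" if layer: "contact_layer_M dist_cost \<Gamma>"
  proof -
    obtain \<alpha> \<gamma> \<beta> where "(\<alpha>, \<gamma>, \<beta>) \<in> E_M dist_cost (Domain \<Gamma>) (Range \<Gamma>)" "contact_on dist_cost \<Gamma> (\<alpha>, \<gamma>, \<beta>)"
      using layer by (auto simp: contact_layer_M_def)
    then have "signed_contact_layer \<Gamma> \<alpha> \<gamma> \<beta> 1"
      using ic by unfold_locales (auto simp: E_M_def contact_on_def dist_cost_def)
    then show ?thesis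
      by blast
  qed
  show "\<exists>\<alpha> \<gamma> \<beta>. signed_contact_layer \<Gamma> \<alpha> \<gamma> \<beta> (- 1)" if layer: "contact_layer_m dist_cost \<Gamma>"
  proof -
    obtain \<alpha> \<gamma> \<beta> where "(\<alpha>, \<gamma>, \<beta>) \<in> E_m dist_cost (Domain \<Gamma>) (Range \<Gamma>)" "contact_on dist_cost \<Gamma> (\<alpha>, \<gamma>, \<beta>)"
      using layer by (auto simp: contact_layer_m_def)
    then have "signed_contact_layer \<Gamma> \<alpha> \<gamma> \<beta> (- 1)"
      using ic by unfold_locales (auto simp: E_m_def contact_on_def dist_cost_def)
    then show ?thesis
      by blast
  qed
qed

theorem theorem2p4:
  shows "(\<forall>(c :: 'a::euclidean_space \<Rightarrow> 'a \<Rightarrow> real) \<Gamma>.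
            (c = dist_cost \<or> c = neg_dist_cost) \<and>
            \<Gamma> \<in> S_MT \<and> contact_layer c \<Gamma> \<and>
            (maximization_case c \<Gamma> \<or>
             minimization_case c \<Gamma> \<and> (\<forall>x\<in>Domain \<Gamma>. x \<notin> \<Gamma> `` {x}))
            \<longrightarrow> (AE x in lebesgue. x \<in> Domain \<Gamma> \<longrightarrow>
                  closure (\<Gamma> `` {x}) = Ext (convex hull (closure (\<Gamma> `` {x})))))
       \<and>
         (\<forall>(\<mu> :: 'a measure) (\<nu> :: 'a measure) \<pi> \<kappa>.
            prob_space \<mu> \<and> sets \<mu> = sets borel \<and>
            prob_space \<nu> \<and> sets \<nu> = sets borel \<and>
            convex_order \<mu> \<nu> \<and> absolutely_continuous lborel \<mu> \<and>
            \<pi> \<in> MT \<mu> \<nu> \<and> disintegration \<mu> \<pi> \<kappa> \<and>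
            (solves_min dist_cost \<mu> \<nu> \<pi> \<and> inf \<mu> \<nu> = null_measure borel \<and>
               dual_min_attained dist_cost \<mu> \<nu> \<or>
             solves_max dist_cost \<mu> \<nu> \<pi> \<and> dual_max_attained dist_cost \<mu> \<nu>)
            \<longrightarrow> (AE x in \<mu>. supp (\<kappa> x) = Ext (convex hull (supp (\<kappa> x)))))"
proof (intro conjI allI impI; elim conjE)
  fix c :: "'a \<Rightarrow> 'a \<Rightarrow> real" and \<Gamma>
  assume S: "\<Gamma> \<in> S_MT"
    and cases: "maximization_case c \<Gamma> \<or> minimization_case c \<Gamma> \<and> (\<forall>x\<in>Domain \<Gamma>. x \<notin> \<Gamma> `` {x})"
  have "negligible {x \<in> Domain \<Gamma>. closure (\<Gamma> `` {x}) \<noteq> Ext (convex hull (closure (\<Gamma> `` {x})))}"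
    using cases
  proof (elim disjE conjE)
    assume "maximization_case c \<Gamma>"
    then obtain \<alpha> \<gamma> \<beta> where "signed_contact_layer \<Gamma> \<alpha> \<gamma> \<beta> 1"
      using signed_contact_layer_of_contact_layer(1)[OF S] maximization_case_imp_contact_layer_M by blast
    then show ?thesis
      by (rule signed_contact_layer.negligible_not_extreme) simp
  next
    assume "minimization_case c \<Gamma>" and off: "\<forall>x\<in>Domain \<Gamma>. x \<notin> \<Gamma> `` {x}"
    then obtain \<alpha> \<gamma> \<beta> where "signed_contact_layer \<Gamma> \<alpha> \<gamma> \<beta> (- 1)"
      using signed_contact_layer_of_contact_layer(2)[OF S] minimization_case_imp_contact_layer_m by blast
    then show ?thesis
      by (rule signed_contact_layer.negligible_not_extreme) (use off in blast)
  qed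
  then have "AE x in lebesgue. x \<notin> {x \<in> Domain \<Gamma>. closure (\<Gamma> `` {x}) \<noteq> Ext (convex hull (closure (\<Gamma> `` {x})))}"
    by (intro AE_not_in) (simp add: negligible_iff_null_sets)
  then show "AE x in lebesgue. x \<in> Domain \<Gamma> \<longrightarrow>
      closure (\<Gamma> `` {x}) = Ext (convex hull (closure (\<Gamma> `` {x})))"
    by eventually_elim blast
next
  fix \<mu> \<nu> :: "'a measure" and \<pi> \<kappa>
  assume sets: "sets \<mu> = sets borel" "sets \<nu> = sets borel"
    and order: "convex_order \<mu> \<nu>" and ac: "absolutely_continuous lborel \<mu>"
    and \<pi>: "\<pi> \<in> MT \<mu> \<nu>" and \<kappa>: "disintegration \<mu> \<pi> \<kappa>"
    and optimal: "solves_min dist_cost \<mu> \<nu> \<pi> \<and> inf \<mu> \<nu> = null_measure borel \<and>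
        dual_min_attained dist_cost \<mu> \<nu> \<or>
      solves_max dist_cost \<mu> \<nu> \<pi> \<and> dual_max_attained dist_cost \<mu> \<nu>"
  note extreme = AE_extreme_of_optimal[OF sets order ac \<pi> \<kappa>]
  from optimal show "AE x in \<mu>. supp (\<kappa> x) = Ext (convex hull (supp (\<kappa> x)))"
  proof (elim disjE conjE)
    assume min: "solves_min dist_cost \<mu> \<nu> \<pi>" and singular: "inf \<mu> \<nu> = null_measure borel"
      and "dual_min_attained dist_cost \<mu> \<nu>"
    then obtain \<alpha> \<gamma> \<beta> where t: "(\<alpha>, \<gamma>, \<beta>) \<in> E_m dist_cost UNIV UNIV"
        and int: "integrable \<mu> \<alpha>" "integrable \<nu> \<beta>"
        and dual: "(\<integral>y. \<beta> y \<partial>\<nu>) - (\<integral>x. \<alpha> x \<partial>\<mu>) = (INF \<pi>\<in>MT \<mu> \<nu>. total_cost dist_cost \<pi>)"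
      by (auto simp: dual_min_attained_def)
    have "(INF \<pi>\<in>MT \<mu> \<nu>. total_cost dist_cost \<pi>) = total_cost dist_cost \<pi>"
      using min by (intro cInf_eq_minimum) (auto simp: solves_min_def)
    moreover have "0 \<le> - 1 * (\<beta> y - \<alpha> x - \<gamma> x \<bullet> (y - x) - norm (x - y))" for x y
      using t by (auto simp: E_m_def dist_cost_def)
    ultimately show ?thesis
      using extreme[of "- 1" \<beta> \<alpha> \<gamma>] int dual singular by simp
  next
    assume max: "solves_max dist_cost \<mu> \<nu> \<pi>" and "dual_max_attained dist_cost \<mu> \<nu>"
    then obtain \<alpha> \<gamma> \<beta> where t: "(\<alpha>, \<gamma>, \<beta>) \<in> E_M dist_cost UNIV UNIV"
        and int: "integrable \<mu> \<alpha>" "integrable \<nu> \<beta>"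
        and dual: "(\<integral>y. \<beta> y \<partial>\<nu>) - (\<integral>x. \<alpha> x \<partial>\<mu>) = (SUP \<pi>\<in>MT \<mu> \<nu>. total_cost dist_cost \<pi>)"
      by (auto simp: dual_max_attained_def)
    have "(SUP \<pi>\<in>MT \<mu> \<nu>. total_cost dist_cost \<pi>) = total_cost dist_cost \<pi>"
      using max by (intro cSup_eq_maximum) (auto simp: solves_max_def)
    moreover have "0 \<le> 1 * (\<beta> y - \<alpha> x - \<gamma> x \<bullet> (y - x) - norm (x - y))" for x y
      using t by (auto simp: E_M_def dist_cost_def)
    ultimately show ?thesis
      using extreme[of 1 \<beta> \<alpha> \<gamma>] int dual by simp
  qed
qed

end
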